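(* Let $L$ be a hyperbolic lattice of rank $r$ and let $G$ be a subgroup of $\mathrm{O}(L)$. Assume that $G$ is virtually solvable. Then $G$ is almost abelian of finite rank.
   Context: A lattice $L$ is a free abelian group $L\simeq\mathbf{Z}^r$ together with a (possibly degenerate) integral-valued symmetric bilinear form $L\times L\to\mathbf{Z}$. It is hyperbolic if its signature (numbers of positive, zero and negative eigenvalues of a symmetric matrix associated to the form) is $(1,0,r-1)$. $\mathrm{O}(L)$ is the group of isometries of $L$. A group is virtually solvable if it contains a solvable subgroup of finite index. A group $G$ is almost abelian of finite rank if, for some integer $s\ge 0$, it contains a subgroup $A$ of finite index fitting into an exact sequence $1\to F\to A\to\mathbf{Z}^s\to 0$ with $F$ a finite group. *)

theory Defs
  imports
    "HOL-Algebra.Bij"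
    "HOL-Algebra.Solvable_Groups"
    "HOL-Algebra.Free_Abelian_Groups"
    "Jordan_Normal_Form.Char_Poly"
begin

abbreviation Z_power :: "nat \<Rightarrow> (nat \<Rightarrow>\<^sub>0 int) monoid"
  where "Z_power r \<equiv> free_Abelian_group {..<r}"

text \<open>The group \<open>L\<close> is written multiplicatively, as usual in HOL-Algebra.
  The form may be degenerate.\<close>

locale integral_lattice = comm_group L
  for L :: "('a, 'b) monoid_scheme" (structure)
    and B :: "'a \<Rightarrow> 'a \<Rightarrow> int"
    and r :: nat +
  assumes free: "Z_power r \<cong> L"
    and form_sym: "\<lbrakk>x \<in> carrier L; y \<in> carrier L\<rbrakk> \<Longrightarrow> B x y = B y x"
    and form_add: "\<lbrakk>x \<in> carrier L; y \<in> carrier L; z \<in> carrier L\<rbrakk>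
      \<Longrightarrow> B (x \<otimes> y) z = B x z + B y z"

text \<open>An isomorphism \<open>\<phi>\<close> from \<open>Z_power r\<close> to \<open>L\<close> encodes the basis \<open>\<phi> (frag_of 0), \<dots>, \<phi> (frag_of (r - 1))\<close>.\<close>

definition gram_matrix :: "('a \<Rightarrow> 'a \<Rightarrow> int) \<Rightarrow> nat \<Rightarrow> ((nat \<Rightarrow>\<^sub>0 int) \<Rightarrow> 'a) \<Rightarrow> real mat" where
  "gram_matrix B r \<phi> =
     mat r r (\<lambda>(i, j). real_of_int (B (\<phi> (frag_of i)) (\<phi> (frag_of j))))"

text \<open>Eigenvalues are counted with multiplicity; for a real symmetric matrix the
  characteristic polynomial splits over the reals, so none are lost.\<close>

definition matrix_signature :: "real mat \<Rightarrow> nat \<times> nat \<times> nat" where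
  "matrix_signature M =
     (let E = proots (char_poly M)
      in (size {#a \<in># E. a > 0#}, size {#a \<in># E. a = 0#}, size {#a \<in># E. a < 0#}))"

text \<open>By Sylvester's law of inertia the choice of the basis does not matter.
  In rank \<open>0\<close> the signature is \<open>(0, 0, 0)\<close>, so \<open>r > 0\<close> is implied despite truncated subtraction.\<close>

locale hyperbolic_lattice = integral_lattice +
  assumes hyperbolic: "\<exists>\<phi> \<in> iso (Z_power r) L. matrix_signature (gram_matrix B r \<phi>) = (1, 0, r - 1)"

definition isometries :: "('a, 'b) monoid_scheme \<Rightarrow> ('a \<Rightarrow> 'a \<Rightarrow> int) \<Rightarrow> ('a \<Rightarrow> 'a) set" where
  "isometries L B = {f \<in> auto L. \<forall>x \<in> carrier L. \<forall>y \<in> carrier L. B (f x) (f y) = B x y}"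

definition isometry_group :: "('a, 'b) monoid_scheme \<Rightarrow> ('a \<Rightarrow> 'a \<Rightarrow> int) \<Rightarrow> ('a \<Rightarrow> 'a) monoid"
  where "isometry_group L B = AutoGroup L \<lparr>carrier := isometries L B\<rparr>"

lemma (in group) subgroup_isometries: "subgroup (isometries G B) (AutoGroup G)"
proof -
  interpret Aut: group "AutoGroup G"
    by (rule AutoGroup)
  have carrier: "carrier (AutoGroup G) = auto G"
    by (simp add: AutoGroup_def)
  have inv: "inv\<^bsub>AutoGroup G\<^esub> f = (\<lambda>x \<in> carrier G. inv_into (carrier G) f x)" if "f \<in> auto G" for f
    using that subgroup_auto group_BijGroup[of "carrier G"]
    by (simp add: AutoGroup_def group.m_inv_consistent inv_BijGroup auto_def)
  show ?thesis
  proof (rule Aut.subgroupI)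
    show "isometries G B \<subseteq> carrier (AutoGroup G)"
      by (auto simp: carrier isometries_def)
    have "(\<lambda>x \<in> carrier G. x) \<in> isometries G B"
      by (simp add: isometries_def id_in_auto)
    then show "isometries G B \<noteq> {}"
      by blast
  next
    fix f assume f: "f \<in> isometries G B"
    then have aut: "f \<in> auto G"
      by (simp add: isometries_def)
    then have bij: "bij_betw f (carrier G) (carrier G)"
      by (simp add: auto_def Bij_def)
    have "B (inv_into (carrier G) f x) (inv_into (carrier G) f y) = B x y"
      if "x \<in> carrier G" "y \<in> carrier G" for x y
    proof -
      have "inv_into (carrier G) f x \<in> carrier G" "inv_into (carrier G) f y \<in> carrier G"
        using bij that bij_betw_apply bij_betw_inv_into by fast+
      then have "B (f (inv_into (carrier G) f x)) (f (inv_into (carrier G) f y)) =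
          B (inv_into (carrier G) f x) (inv_into (carrier G) f y)"
        using f by (simp add: isometries_def)
      then show ?thesis
        using bij that by (simp add: bij_betw_inv_into_right)
    qed
    moreover have "inv\<^bsub>AutoGroup G\<^esub> f \<in> auto G"
      using Aut.inv_closed aut carrier by simp
    ultimately show "inv\<^bsub>AutoGroup G\<^esub> f \<in> isometries G B"
      by (simp add: isometries_def inv[OF aut])
  next
    fix f g assume fg: "f \<in> isometries G B" "g \<in> isometries G B"
    then have aut: "f \<in> auto G" "g \<in> auto G"
      by (simp_all add: isometries_def)
    then have eq: "f \<otimes>\<^bsub>AutoGroup G\<^esub> g = compose (carrier G) f g"
      by (simp add: AutoGroup_def BijGroup_def auto_def)
    have "f \<otimes>\<^bsub>AutoGroup G\<^esub> g \<in> auto G"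
      using Aut.m_closed aut carrier by simp
    moreover have "g x \<in> carrier G" if "x \<in> carrier G" for x
      using aut(2) that by (auto simp: auto_def hom_def)
    ultimately show "f \<otimes>\<^bsub>AutoGroup G\<^esub> g \<in> isometries G B"
      using fg by (simp add: isometries_def eq compose_eq)
  qed
qed

lemma (in group) group_isometry_group: "group (isometry_group G B)"
  unfolding isometry_group_def
  using subgroup.subgroup_is_group[OF subgroup_isometries AutoGroup] .

definition finite_index :: "('a, 'b) monoid_scheme \<Rightarrow> 'a set \<Rightarrow> bool" where
  "finite_index G H \<longleftrightarrow> finite (rcosets\<^bsub>G\<^esub> H)"

definition virtually_solvable :: "('a, 'b) monoid_scheme \<Rightarrow> bool" where
  "virtually_solvable G \<longleftrightarrow>
     (\<exists>H. subgroup H G \<and> finite_index G H \<and> solvable (G\<lparr>carrier := H\<rparr>))"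

text \<open>The finite group \<open>F\<close> embeds into \<open>G\<close>, so taking its elements in the type of those of
  \<open>G\<close> is no restriction.\<close>

definition almost_abelian_finite_rank :: "('a, 'b) monoid_scheme \<Rightarrow> bool" where
  "almost_abelian_finite_rank G \<longleftrightarrow>
     (\<exists>(s :: nat) A (F :: 'a monoid) i p.
        subgroup A G \<and> finite_index G A \<and>
        group F \<and> finite (carrier F) \<and>
        i \<in> mon F (G\<lparr>carrier := A\<rparr>) \<and>
        p \<in> epi (G\<lparr>carrier := A\<rparr>) (Z_power s) \<and>
        i ` carrier F = kernel (G\<lparr>carrier := A\<rparr>) (Z_power s) p)"

end

theory Submission
  imports Defs "HOL-Analysis.L2_Norm"
begin

text \<open>Over the reals, the form of a hyperbolic lattice of rank \<open>r\<close> is a Lorentz form on \<open>\<real>\<^sup>r\<close>, and the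
  isometries of the lattice are integral matrices that preserve it. They act on hyperbolic space, realized
  by the positive vectors, and the isotropic lines are the points at infinity. The action is discrete: only
  finitely many integral isometries move a given positive vector by a bounded amount
  (\<open>finite_of_bounded_displacement\<close>). Everything else rests on this.

  Let \<open>H\<close> be a solvable group of such isometries. If it is infinite, let \<open>D\<close> be the last infinite member of its
  derived series; \<open>D\<close> is normal in \<open>H\<close> and commutative up to a finite set. The translates of a
  positive vector by distinct elements of \<open>D\<close> diverge, and after rescaling they accumulate at an isotropic line.
  Any two isotropic vectors that are orthogonal are proportional, and from this it follows that an
  element that commutes with \<open>D\<close> up to a finite set fixes this line (\<open>isotropic_limit_line\<close>). So
  \<open>D\<close> fixes an isotropic line. It fixes at most two, since a group that fixes three acts on a
  positive vector by signs and is finite. As \<open>H\<close> permutes these lines, a subgroup of index at most two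
  fixes one of them, spanned by \<open>e\<close> (\<open>infinite_normal_almost_commutative_subgroup_fixes_line\<close>).

  A group fixing the line of \<open>e\<close> acts on it by a multiplier, and two cases arise. If some multiplier does not have
  absolute value \<open>1\<close>, then discreteness forces the group to fix a second isotropic line, and the logarithm of the
  multiplier is a homomorphism to a discrete group of real numbers with finite kernel
  (\<open>virtually_finite_by_lattice_of_loxodromic\<close>). Otherwise, unless only finitely many elements fix \<open>e\<close>, the line
  of \<open>e\<close> contains an integral vector \<open>w\<close> (\<open>integral_fixed_vector\<close>). The group acts through a finite group on the
  complement of \<open>w\<close> modulo \<open>w\<close>, which is negative definite, and the elements of the kernel that
  fix \<open>w\<close> form a group that embeds into \<open>\<int>\<^sup>r\<close> (\<open>virtually_finite_by_lattice_of_parabolic\<close>).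

  In all cases a subgroup of finite index maps to some \<open>\<int>\<^sup>n\<close> with finite kernel. The image is free
  abelian (\<open>homomorphism_onto_lattice\<close>), which gives the required exact sequence.\<close>

section \<open>Finite index and homomorphisms to lattices\<close>

text \<open>A finite index is shown below by exhibiting an invariant with finitely many values that
  separates the right cosets.\<close>

lemma (in group) finite_index_of_invariant:
  assumes A: "subgroup A G" and fin: "finite (\<tau> ` carrier G)"
    and inv: "\<And>g h. \<lbrakk>g \<in> carrier G; h \<in> carrier G; \<tau> g = \<tau> h\<rbrakk> \<Longrightarrow> g \<otimes> inv h \<in> A"
  shows "finite_index G A"
proof -
  define f where "f t = A #> (SOME g. g \<in> carrier G \<and> \<tau> g = t)" for t
  have "A #> g = f (\<tau> g)" if g: "g \<in> carrier G" for g
  proof -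
    define h where "h = (SOME h. h \<in> carrier G \<and> \<tau> h = \<tau> g)"
    have "h \<in> carrier G \<and> \<tau> h = \<tau> g"
      unfolding h_def by (rule someI[of _ g]) (simp add: g)
    then have h: "h \<in> carrier G" "\<tau> h = \<tau> g" by auto
    have "(h \<otimes> inv g) \<otimes> g \<in> A #> g"
      using inv[OF h(1) g h(2)] subgroup.subset[OF A] g by (intro rcosI) auto
    then have "h \<in> A #> g" using g h by (simp add: m_assoc)
    then have "A #> g = A #> h" using repr_independence[OF _ g A] by blast
    then show ?thesis by (simp add: f_def h_def)
  qed
  then have "rcosets A \<subseteq> f ` \<tau> ` carrier G" unfolding RCOSETS_def by auto
  then show ?thesis unfolding finite_index_def using fin finite_subset by blast
qed

lemma (in group) inv_mem_of_rcoset_eq: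
  assumes A: "subgroup A G" and g: "g \<in> carrier G" and h: "h \<in> carrier G" and eq: "A #> g = A #> h"
  shows "g \<otimes> inv h \<in> A"
proof -
  have "g \<in> A #> h" using rcos_self[OF g A] eq by simp
  then obtain a where a: "a \<in> A" "g = a \<otimes> h" unfolding r_coset_def by auto
  then show ?thesis using h subgroup.mem_carrier[OF A] by (simp add: m_assoc)
qed

lemma (in group) finite_index_trans:
  assumes H: "subgroup H G" "finite_index G H"
    and A: "subgroup A (G\<lparr>carrier := H\<rparr>)" "finite_index (G\<lparr>carrier := H\<rparr>) A"
  shows "finite_index G A"
proof -
  interpret H: group "G\<lparr>carrier := H\<rparr>" using H(1) by (rule subgroup_imp_group)
  have AG: "subgroup A G" using incl_subgroup[OF H(1) A(1)] .
  define rep where "rep C = (SOME g. g \<in> carrier G \<and> H #> g = C)" for C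
  have rep: "rep (H #> g) \<in> carrier G \<and> H #> rep (H #> g) = H #> g" if "g \<in> carrier G" for g
    unfolding rep_def by (rule someI[of _ g]) (simp add: that)
  have diff: "g \<otimes> inv (rep (H #> g)) \<in> H" if "g \<in> carrier G" for g
    using inv_mem_of_rcoset_eq[OF H(1) that] rep[OF that] by simp
  \<comment> \<open>The coset of \<open>g\<close> modulo \<open>H\<close>, and the coset modulo \<open>A\<close> of the element of \<open>H\<close> by which \<open>g\<close>
    differs from the chosen representative.\<close>
  define \<tau> where "\<tau> g = (H #> g, A #>\<^bsub>G\<lparr>carrier := H\<rparr>\<^esub> (g \<otimes> inv (rep (H #> g))))" for g
  show ?thesis
  proof (rule finite_index_of_invariant[OF AG])
    have "\<tau> ` carrier G \<subseteq> (rcosets H) \<times> (rcosets\<^bsub>G\<lparr>carrier := H\<rparr>\<^esub> A)"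
      using diff unfolding \<tau>_def RCOSETS_def by auto
    then show "finite (\<tau> ` carrier G)"
      using H(2) A(2) finite_subset unfolding finite_index_def by (metis finite_cartesian_product)
    fix g h assume g: "g \<in> carrier G" and h: "h \<in> carrier G" and eq: "\<tau> g = \<tau> h"
    define k where "k = rep (H #> g)"
    have k: "k \<in> carrier G" "rep (H #> h) = k" using rep[OF g] eq by (auto simp: k_def \<tau>_def)
    have "(g \<otimes> inv k) \<otimes>\<^bsub>G\<lparr>carrier := H\<rparr>\<^esub> inv\<^bsub>G\<lparr>carrier := H\<rparr>\<^esub> (h \<otimes> inv k) \<in> A"
      using H.inv_mem_of_rcoset_eq[OF A(1)] diff[OF g] diff[OF h] eq k by (simp add: \<tau>_def flip: k_def)
    moreover have "inv\<^bsub>G\<lparr>carrier := H\<rparr>\<^esub> (h \<otimes> inv k) = inv (h \<otimes> inv k)"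
      using m_inv_consistent[OF H(1)] diff[OF h] k by simp
    ultimately show "g \<otimes> inv h \<in> A"
      using g h k by (simp add: inv_mult_group m_assoc) (simp add: m_assoc[symmetric])
  qed
qed

lemma (in group) finite_index_carrier: "finite_index G (carrier G)"
  by (rule finite_index_of_invariant[where \<tau> = "\<lambda>_. ()"]) (auto simp: subgroup_self)

lemma (in group) additive_one:
  fixes \<psi> :: "'a \<Rightarrow> 'c :: ab_group_add"
  assumes "\<And>g h. g \<in> carrier G \<Longrightarrow> h \<in> carrier G \<Longrightarrow> \<psi> (g \<otimes> h) = \<psi> g + \<psi> h"
  shows "\<psi> \<one> = 0"
  using assms[of \<one> \<one>] by simp

lemma (in group) additive_inv:
  fixes \<psi> :: "'a \<Rightarrow> 'c :: ab_group_add"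
  assumes "\<And>g h. g \<in> carrier G \<Longrightarrow> h \<in> carrier G \<Longrightarrow> \<psi> (g \<otimes> h) = \<psi> g + \<psi> h" and g: "g \<in> carrier G"
  shows "\<psi> (inv g) = - \<psi> g"
  using assms(1)[OF inv_closed[OF g] g] additive_one[of \<psi>, OF assms(1)] g by (simp add: eq_neg_iff_add_eq_0)

lemma (in group) additive_int_pow:
  fixes \<psi> :: "'a \<Rightarrow> 'c :: ring_1"
  assumes add: "\<And>g h. g \<in> carrier G \<Longrightarrow> h \<in> carrier G \<Longrightarrow> \<psi> (g \<otimes> h) = \<psi> g + \<psi> h" and g: "g \<in> carrier G"
  shows "\<psi> (g [^] (k :: int)) = of_int k * \<psi> g"
proof -
  have nat: "\<psi> (g [^] n) = of_nat n * \<psi> g" for n :: nat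
    by (induction n) (use g additive_one[of \<psi>, OF add] in \<open>simp_all add: add algebra_simps\<close>)
  show ?thesis
  proof (cases k)
    case (nonneg n)
    then show ?thesis using nat by (simp add: int_pow_int)
  next
    case (neg n)
    then show ?thesis
      using nat[of "Suc n"] additive_inv[of \<psi>, OF add nat_pow_closed[OF g, of "Suc n"]] g
      by (simp add: int_pow_neg int_pow_int del: nat_pow_Suc of_int_of_nat_eq of_nat_Suc) simp
  qed
qed

text \<open>A discrete subgroup of the real line is cyclic: the least positive value \<open>c\<close> divides every
  other value, because a remainder would be a smaller positive value.\<close>

lemma (in group) discrete_real_homomorphism:
  fixes \<psi> :: "'a \<Rightarrow> real"
  assumes add: "\<And>g h. g \<in> carrier G \<Longrightarrow> h \<in> carrier G \<Longrightarrow> \<psi> (g \<otimes> h) = \<psi> g + \<psi> h"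
    and fin: "\<And>K. finite {g \<in> carrier G. \<bar>\<psi> g\<bar> \<le> K}"
  obtains \<psi>' :: "'a \<Rightarrow> int" and c :: real where
    "0 < c" "\<And>g. g \<in> carrier G \<Longrightarrow> \<psi> g = c * \<psi>' g"
proof (cases "\<exists>g \<in> carrier G. \<psi> g \<noteq> 0")
  case False
  then show ?thesis by (intro that[of 1 "\<lambda>_. 0"]) auto
next
  case True
  then obtain g0 where g0: "g0 \<in> carrier G" "\<psi> g0 > 0"
    using additive_inv[of \<psi>, OF add] by (metis inv_closed neg_0_less_iff_less linorder_neqE_linordered_idom)
  define T where "T = \<psi> ` {g \<in> carrier G. 0 < \<psi> g \<and> \<psi> g \<le> \<psi> g0}"
  have "T \<subseteq> \<psi> ` {g \<in> carrier G. \<bar>\<psi> g\<bar> \<le> \<psi> g0}" unfolding T_def by auto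
  then have T: "finite T" using fin finite_subset by blast
  have T0: "\<psi> g0 \<in> T" using g0 by (auto simp: T_def)
  define c where "c = Min T"
  have "c \<in> T" unfolding c_def using T T0 by (intro Min_in) auto
  then obtain g1 where g1: "g1 \<in> carrier G" "c = \<psi> g1" "0 < c" by (auto simp: T_def)
  have min: "c \<le> \<psi> g" if "g \<in> carrier G" "0 < \<psi> g" for g
  proof (cases "\<psi> g \<le> \<psi> g0")
    case True
    then show ?thesis unfolding c_def using that T by (intro Min_le) (auto simp: T_def)
  next
    case False
    then show ?thesis using Min_le[OF T T0] by (simp add: c_def)
  qed
  have "\<psi> g = c * \<lfloor>\<psi> g / c\<rfloor>" if g: "g \<in> carrier G" for g
  proof -
    define k where "k = \<lfloor>\<psi> g / c\<rfloor>"
    have eq: "\<psi> (g \<otimes> g1 [^] (- k)) = \<psi> g - k * c"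
      using add[OF g int_pow_closed[OF g1(1)], of "- k"] additive_int_pow[of \<psi>, OF add g1(1), of "- k"] g1(2) by simp
    have "k \<le> \<psi> g / c" "\<psi> g / c < k + 1" unfolding k_def by linarith+
    then have "k * c \<le> \<psi> g" "\<psi> g - k * c < c" using g1(3) by (simp_all add: field_simps)
    then have "\<psi> g - k * c = 0"
      using min[of "g \<otimes> g1 [^] (- k)"] eq g g1(1) by fastforce
    then show ?thesis by (simp add: k_def mult.commute)
  qed
  then show ?thesis by (intro that[of c "\<lambda>g. \<lfloor>\<psi> g / c\<rfloor>"] g1(3))
qed

text \<open>Every subgroup of a free abelian group of finite rank is free: here in terms of a homomorphism
  from an arbitrary group, whose image is identified with a standard lattice without changing
  the kernel. The last coordinate has image \<open>c \<int>\<close>. If \<open>c \<noteq> 0\<close>, an element \<open>a\<close> with last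
  coordinate \<open>c\<close> splits off one copy of \<open>\<int>\<close>, and \<open>g a\<^sup>-\<^sup>k\<close> brings every \<open>g\<close> into the subgroup
  where the last coordinate vanishes.\<close>

lemma (in group) extend_homomorphism_onto_lattice:
  fixes \<psi> :: "'a \<Rightarrow> nat \<Rightarrow> int" and s :: nat
  assumes add: "\<And>g h i. \<lbrakk>g \<in> carrier G; h \<in> carrier G; i < Suc n\<rbrakk> \<Longrightarrow> \<psi> (g \<otimes> h) i = \<psi> g i + \<psi> h i"
    and G0_def: "G0 = {g \<in> carrier G. \<psi> g n = 0}"
    and p: "p \<in> epi (G\<lparr>carrier := G0\<rparr>) (Z_power s)" "\<And>g. g \<in> G0 \<Longrightarrow> p g = 0 \<longleftrightarrow> (\<forall>i<n. \<psi> g i = 0)"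
  shows "\<exists>(s :: nat) p. p \<in> epi G (Z_power s) \<and>
    (\<forall>g \<in> carrier G. p g = 0 \<longleftrightarrow> (\<forall>i<Suc n. \<psi> g i = 0))"
proof -
  have invn: "\<psi> (inv g) i = - \<psi> g i" if "g \<in> carrier G" "i < Suc n" for g i
    using additive_inv[of "\<lambda>g. \<psi> g i", OF add[OF _ _ that(2)] that(1)] by simp
  have sub: "subgroup G0 G"
  proof (rule subgroupI)
    have "\<psi> \<one> n = 0" using additive_one[of "\<lambda>g. \<psi> g n", OF add] by simp
    then have "\<one> \<in> G0" by (simp add: G0_def)
    then show "G0 \<noteq> {}" by blast
    show "G0 \<subseteq> carrier G" by (auto simp: G0_def)
    show "inv g \<in> G0" if "g \<in> G0" for g using that invn[of g n] by (simp add: G0_def)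
    show "g \<otimes> h \<in> G0" if "g \<in> G0" "h \<in> G0" for g h using that add[of g h n] by (simp add: G0_def)
  qed
  have p_add: "p (g \<otimes> h) = p g + p h" if "g \<in> G0" "h \<in> G0" for g h
    using p(1) that by (auto simp: epi_def hom_def)
  have p_image: "p ` G0 = carrier (Z_power s)" using p(1) by (simp add: epi_def)
  have p_keys: "Poly_Mapping.keys (p g) \<subseteq> {..<s}" if "g \<in> G0" for g
    using imageI[OF that, of p] unfolding p_image by simp
  have p_surj: "\<exists>g \<in> G0. p g = z" if "Poly_Mapping.keys z \<subseteq> {..<s}" for z
  proof -
    have "z \<in> p ` G0" using that unfolding p_image by simp
    then show ?thesis by blast
  qed
  have p_eq: "p g = p h" if "g \<in> G0" "h \<in> G0" "\<And>i. i < n \<Longrightarrow> \<psi> g i = \<psi> h i" for g h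
  proof -
    have ih: "inv h \<in> G0" using subgroup.m_inv_closed[OF sub that(2)] .
    have "p (g \<otimes> inv h) = 0"
      using p(2)[of "g \<otimes> inv h"] subgroup.m_closed[OF sub that(1) ih] that add invn by (auto simp: G0_def)
    moreover have "p \<one> = 0"
      using p_add[of \<one> \<one>] subgroup.one_closed[OF sub] by simp
    then have "p (h \<otimes> inv h) = 0" using that(2) by (simp add: G0_def)
    ultimately show ?thesis using p_add that ih by (metis add_right_cancel)
  qed
  show ?thesis
  proof (cases "G0 = carrier G")
    case True
    then have "p \<in> epi G (Z_power s)" using p(1) by simp
    moreover have "p g = 0 \<longleftrightarrow> (\<forall>i<Suc n. \<psi> g i = 0)" if "g \<in> carrier G" for g
    proof -
      have "g \<in> G0" using that True by simp
      then show ?thesis using p(2)[of g] by (auto simp: G0_def less_Suc_eq)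
    qed
    ultimately show ?thesis by (intro exI[of _ s] exI[of _ p]) simp
  next
    case False
    then obtain b where b: "b \<in> carrier G" "\<psi> b n \<noteq> 0" by (auto simp: G0_def)
    define P where "P k \<longleftrightarrow> 0 < k \<and> (\<exists>g \<in> carrier G. \<psi> g n = int k)" for k
    define c where "c = (LEAST k. P k)"
    have "P (nat \<bar>\<psi> b n\<bar>)"
      using b invn[OF b(1), of n] by (cases "\<psi> b n > 0") (auto simp: P_def intro: bexI[of _ b] bexI[of _ "inv b"])
    then have "P c" unfolding c_def by (rule LeastI)
    then have c: "0 < c" "\<exists>g \<in> carrier G. \<psi> g n = int c" by (auto simp: P_def)
    have c_min: "c \<le> k" if "0 < k" "g \<in> carrier G" "\<psi> g n = int k" for k g
      unfolding c_def by (rule Least_le) (use that in \<open>auto simp: P_def\<close>)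
    obtain a where a: "a \<in> carrier G" "\<psi> a n = int c" using c by blast
    have pow: "\<psi> (a [^] (k :: int)) i = k * \<psi> a i" if "i < Suc n" for k i
      using additive_int_pow[of "\<lambda>g. \<psi> g i" a k] add a that by simp
    have div: "int c dvd \<psi> g n" if g: "g \<in> carrier G" for g
    proof -
      define k where "k = \<psi> g n div int c"
      have "\<psi> (g \<otimes> a [^] (- k)) n = \<psi> g n mod int c"
        using add[OF g int_pow_closed[OF a(1)]] pow[of n "- k"] a by (simp add: k_def minus_div_mult_eq_mod[symmetric])
      then have "\<not> (0 < nat (\<psi> g n mod int c) \<and> nat (\<psi> g n mod int c) < c)"
        using c_min[of "nat (\<psi> g n mod int c)" "g \<otimes> a [^] (- k)"] g a(1) c(1) by auto
      moreover have "nat (\<psi> g n mod int c) < c" using c(1) pos_mod_bound[of "int c" "\<psi> g n"] by linarith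
      ultimately have "\<psi> g n mod int c \<le> 0" by simp
      moreover have "0 \<le> \<psi> g n mod int c" using c(1) by simp
      ultimately have "\<psi> g n mod int c = 0" by linarith
      then show ?thesis by (simp add: dvd_eq_mod_eq_0)
    qed
    define k where "k g = \<psi> g n div int c" for g
    have k: "\<psi> g n = k g * int c" if "g \<in> carrier G" for g
      unfolding k_def by (rule dvd_div_mult_self[OF div[OF that], symmetric])
    have k_add: "k (g \<otimes> h) = k g + k h" if "g \<in> carrier G" "h \<in> carrier G" for g h
      using div[OF that(1)] div[OF that(2)] add that by (simp add: k_def div_plus_div_distrib_dvd_left)
    define q where "q g = g \<otimes> a [^] (- k g)" for g
    have q_psi: "\<psi> (q g) i = \<psi> g i - k g * \<psi> a i" if "g \<in> carrier G" "i < Suc n" for g i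
      unfolding q_def using add[OF that(1) int_pow_closed[OF a(1)] that(2)] pow[OF that(2)] by simp
    have q: "q g \<in> G0" if "g \<in> carrier G" for g
      using q_psi[OF that, of n] k[OF that] that a by (simp add: G0_def) (simp add: q_def)
    define p' where "p' g = p (q g) + frag_cmul (k g) (frag_of s)" for g
    have p'_add: "p' (g \<otimes> h) = p' g + p' h" if g: "g \<in> carrier G" and h: "h \<in> carrier G" for g h
    proof -
      have "p (q (g \<otimes> h)) = p (q g \<otimes> q h)"
      proof (rule p_eq)
        show "q g \<otimes> q h \<in> G0" using subgroup.m_closed[OF sub q[OF g] q[OF h]] .
        show "\<psi> (q (g \<otimes> h)) i = \<psi> (q g \<otimes> q h) i" if "i < n" for i
          using that g h q[OF g] q[OF h] by (simp add: q_psi add k_add G0_def algebra_simps)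
      qed (use q g h in auto)
      then show ?thesis using k_add[OF g h] p_add[OF q[OF g] q[OF h]] by (simp add: p'_def frag_cmul_distrib)
    qed
    have look: "Poly_Mapping.lookup (p' g) s = k g" if "g \<in> carrier G" for g
      using p_keys[OF q[OF that]] by (auto simp: p'_def lookup_add in_keys_iff)
    have zero: "p' g = 0 \<longleftrightarrow> (\<forall>i<Suc n. \<psi> g i = 0)" if g: "g \<in> carrier G" for g
    proof
      assume 0: "p' g = 0"
      then have k0: "k g = 0" using look[OF g] by simp
      then have "p (q g) = 0" using 0 by (simp add: p'_def)
      then have "\<forall>i<n. \<psi> g i = 0" using p(2)[OF q[OF g]] q_psi[OF g] k0 by simp
      then show "\<forall>i<Suc n. \<psi> g i = 0" using k[OF g] k0 by (simp add: less_Suc_eq)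
    next
      assume 0: "\<forall>i<Suc n. \<psi> g i = 0"
      then have "k g = 0" by (simp add: k_def)
      moreover have "p (q g) = 0" using p(2)[OF q[OF g]] q_psi[OF g] 0 \<open>k g = 0\<close> by simp
      ultimately show "p' g = 0" by (simp add: p'_def)
    qed
    have keys: "Poly_Mapping.keys (p' g) \<subseteq> {..<Suc s}" if "g \<in> carrier G" for g
    proof -
      have "Poly_Mapping.keys (p' g) \<subseteq> Poly_Mapping.keys (p (q g)) \<union> Poly_Mapping.keys (frag_cmul (k g) (frag_of s))"
        unfolding p'_def by (rule keys_add)
      also have "\<dots> \<subseteq> {..<s} \<union> {s}"
        using p_keys[OF q[OF that]] keys_cmul[of "k g" "frag_of s"] by auto
      finally show ?thesis by auto
    qed
    have surj: "z \<in> p' ` carrier G" if z: "Poly_Mapping.keys z \<subseteq> {..<Suc s}" for z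
    proof -
      define m where "m = Poly_Mapping.lookup z s"
      define z0 where "z0 = z - frag_cmul m (frag_of s)"
      have "Poly_Mapping.keys z0 \<subseteq> {..<s}"
      proof
        fix i assume "i \<in> Poly_Mapping.keys z0"
        then have i: "Poly_Mapping.lookup z0 i \<noteq> 0" by (simp add: in_keys_iff)
        then have "i \<noteq> s" by (intro notI) (simp add: z0_def lookup_minus m_def)
        moreover have "i \<in> Poly_Mapping.keys z"
          using i calculation by (simp add: z0_def lookup_minus in_keys_iff when_def)
        ultimately show "i \<in> {..<s}" using z by fastforce
      qed
      then obtain g where g: "g \<in> G0" "p g = z0" using p_surj by blast
      have gG: "g \<in> carrier G" using g by (simp add: G0_def)
      define h where "h = g \<otimes> a [^] m"
      have h: "h \<in> carrier G" using gG a by (simp add: h_def)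
      have hpsi: "\<psi> h i = \<psi> g i + m * \<psi> a i" if "i < Suc n" for i
        unfolding h_def using add[OF gG int_pow_closed[OF a(1)] that] pow[OF that] by simp
      have kh: "k h = m" using hpsi[of n] g(1) a(2) c(1) by (simp add: k_def G0_def)
      have "p (q h) = p g"
      proof (rule p_eq[OF q[OF h] g(1)])
        show "\<psi> (q h) i = \<psi> g i" if "i < n" for i using that by (simp add: q_psi[OF h] hpsi kh)
      qed
      then have "p' h = z" using kh g by (simp add: p'_def z0_def)
      then show ?thesis using h by blast
    qed
    have "p' \<in> epi G (Z_power (Suc s))"
      using p'_add keys surj by (fastforce simp: epi_def hom_def)
    then show ?thesis using zero by blast
  qed
qed

lemma homomorphism_onto_lattice:
  fixes G :: "('a, 'b) monoid_scheme" and \<psi> :: "'a \<Rightarrow> nat \<Rightarrow> int"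
  assumes "group G"
    and "\<And>g h i. \<lbrakk>g \<in> carrier G; h \<in> carrier G; i < n\<rbrakk> \<Longrightarrow> \<psi> (g \<otimes>\<^bsub>G\<^esub> h) i = \<psi> g i + \<psi> h i"
  shows "\<exists>(s :: nat) p. p \<in> epi G (Z_power s) \<and>
    (\<forall>g \<in> carrier G. p g = 0 \<longleftrightarrow> (\<forall>i<n. \<psi> g i = 0))"
  using assms
proof (induction n arbitrary: G)
  case 0
  have "carrier (Z_power 0) = {0}" by (auto simp: free_Abelian_group_def)
  then have "(\<lambda>_. 0) \<in> epi G (Z_power 0)"
    using group.is_monoid[OF 0(1), THEN monoid.one_closed] by (auto simp: epi_def hom_def)
  then show ?case by (intro exI[of _ 0] exI[of _ "\<lambda>_. 0"]) simp
next
  case (Suc n)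
  define G0 where "G0 = {g \<in> carrier G. \<psi> g n = 0}"
  interpret group G by (rule Suc.prems(1))
  have inv0: "\<psi> (inv\<^bsub>G\<^esub> g) n = - \<psi> g n" if "g \<in> carrier G" for g
    using additive_inv[of "\<lambda>g. \<psi> g n" g] Suc.prems(2) that by simp
  have sub: "subgroup G0 G"
  proof (rule subgroupI)
    have "\<psi> \<one>\<^bsub>G\<^esub> n = 0" using additive_one[of "\<lambda>g. \<psi> g n"] Suc.prems(2) by simp
    then have "\<one>\<^bsub>G\<^esub> \<in> G0" by (simp add: G0_def)
    then show "G0 \<noteq> {}" by blast
  qed (use Suc.prems(2) inv0 in \<open>auto simp: G0_def\<close>)
  have "\<exists>(s :: nat) p. p \<in> epi (G\<lparr>carrier := G0\<rparr>) (Z_power s) \<and>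
    (\<forall>g \<in> carrier (G\<lparr>carrier := G0\<rparr>). p g = 0 \<longleftrightarrow> (\<forall>i<n. \<psi> g i = 0))"
    by (rule Suc.IH) (use Suc.prems(2) subgroup_imp_group[OF sub] in \<open>auto simp: G0_def\<close>)
  then obtain s :: nat and p where "p \<in> epi (G\<lparr>carrier := G0\<rparr>) (Z_power s)"
    "\<And>g. g \<in> G0 \<Longrightarrow> p g = 0 \<longleftrightarrow> (\<forall>i<n. \<psi> g i = 0)" by auto
  then show ?case
    by (intro extend_homomorphism_onto_lattice[where \<psi> = \<psi> and n = n, OF Suc.prems(2) G0_def])
qed

text \<open>Up to finite index, the group maps to \<open>\<int>\<^sup>n\<close> with finite kernel. The \<open>n\<close> coordinates of the
  homomorphism are kept as separate integer-valued functions, which is the form in which they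
  arise below, and the image may be any subgroup of \<open>\<int>\<^sup>n\<close>.\<close>

definition virtually_finite_by_lattice :: "('a, 'b) monoid_scheme \<Rightarrow> bool" where
  "virtually_finite_by_lattice G \<longleftrightarrow>
     (\<exists>A n (\<psi> :: 'a \<Rightarrow> nat \<Rightarrow> int). subgroup A G \<and> finite_index G A \<and>
        (\<forall>g \<in> A. \<forall>h \<in> A. \<forall>i<n. \<psi> (g \<otimes>\<^bsub>G\<^esub> h) i = \<psi> g i + \<psi> h i) \<and>
        finite {g \<in> A. \<forall>i<n. \<psi> g i = 0})"

lemma (in group) virtually_finite_by_lattice_of_subgroup:
  assumes H: "subgroup H G" "finite_index G H" and v: "virtually_finite_by_lattice (G\<lparr>carrier := H\<rparr>)"
  shows "virtually_finite_by_lattice G"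
proof -
  obtain A n and \<psi> :: "'a \<Rightarrow> nat \<Rightarrow> int" where A: "subgroup A (G\<lparr>carrier := H\<rparr>)" "finite_index (G\<lparr>carrier := H\<rparr>) A"
    "\<forall>g \<in> A. \<forall>h \<in> A. \<forall>i<n. \<psi> (g \<otimes> h) i = \<psi> g i + \<psi> h i" "finite {g \<in> A. \<forall>i<n. \<psi> g i = 0}"
    using v unfolding virtually_finite_by_lattice_def by auto
  then show ?thesis
    unfolding virtually_finite_by_lattice_def using incl_subgroup[OF H(1) A(1)] finite_index_trans[OF H A(1,2)] by blast
qed

lemma (in group) almost_abelian_of_virtually_finite_by_lattice:
  assumes "virtually_finite_by_lattice G"
  shows "almost_abelian_finite_rank G"
proof -
  obtain A n and \<psi> :: "'a \<Rightarrow> nat \<Rightarrow> int" where A: "subgroup A G" "finite_index G A"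
    "\<And>g h i. \<lbrakk>g \<in> A; h \<in> A; i < n\<rbrakk> \<Longrightarrow> \<psi> (g \<otimes> h) i = \<psi> g i + \<psi> h i" "finite {g \<in> A. \<forall>i<n. \<psi> g i = 0}"
    using assms unfolding virtually_finite_by_lattice_def by blast
  let ?A = "G\<lparr>carrier := A\<rparr>"
  have grp: "group ?A" using A(1) by (rule subgroup_imp_group)
  obtain s :: nat and p where p: "p \<in> epi ?A (Z_power s)" "\<forall>g \<in> carrier ?A. p g = 0 \<longleftrightarrow> (\<forall>i<n. \<psi> g i = 0)"
    using homomorphism_onto_lattice[OF grp, of n \<psi>] A(3) by auto
  have hom: "group_hom ?A (Z_power s) p"
    using grp p(1) by (auto simp: group_hom_def group_hom_axioms_def epi_def)
  define K where "K = kernel ?A (Z_power s) p"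
  have K: "subgroup K ?A" unfolding K_def by (rule group_hom.subgroup_kernel[OF hom])
  have KA: "K \<subseteq> A" unfolding K_def kernel_def by auto
  define F :: "'a monoid" where "F = \<lparr>carrier = K, monoid.mult = monoid.mult G, one = \<one>\<rparr>"
  have "group (G\<lparr>carrier := K\<rparr>)"
    using subgroup_imp_group incl_subgroup[OF A(1) K] by blast
  then have "group F"
    unfolding group_def monoid_def group_axioms_def F_def Units_def by simp
  moreover have "K = {g \<in> A. \<forall>i<n. \<psi> g i = 0}"
    unfolding K_def kernel_def using p(2) by auto
  then have "finite (carrier F)" using A(4) by (simp add: F_def)
  moreover have "id \<in> mon F ?A"
    using KA by (auto simp: mon_def hom_def F_def)
  moreover have "id ` carrier F = kernel ?A (Z_power s) p" by (simp add: F_def K_def)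
  ultimately show ?thesis
    unfolding almost_abelian_finite_rank_def using A(1,2) p(1) by blast
qed

section \<open>Diagonalization of symmetric matrices\<close>

text \<open>The reflection in the hyperplane orthogonal to \<open>u = e\<^sub>0 - v\<close>, where \<open>e\<^sub>0\<close> is the first unit vector,
  exchanges \<open>e\<^sub>0\<close> and \<open>v\<close>.\<close>

lemma householder_reflection:
  fixes v :: "real vec"
  assumes v: "v \<in> carrier_vec n" and n: "0 < n" and unit: "v \<bullet> v = 1"
  obtains W where "W \<in> carrier_mat n n" "transpose_mat W = W" "W * W = 1\<^sub>m n"
    "W *\<^sub>v unit_vec n 0 = v"
proof -
  define u where "u i = (if i = 0 then 1 else 0) - v $ i" for i
  define s where "s = (\<Sum>k<n. u k * u k)"
  \<comment> \<open>If \<open>v\<close> is the unit vector itself, then \<open>u = 0\<close> and \<open>s = 0\<close>, hence \<open>c = 0\<close> by the convention for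
    division by zero, and \<open>W\<close> is the identity.\<close>
  define c where "c = 2 / s"
  define W where "W = mat n n (\<lambda>(i, j). (if i = j then 1 else 0) - c * u i * u j)"
  have W: "W \<in> carrier_mat n n" by (simp add: W_def)
  have vv: "(\<Sum>k<n. v $ k * v $ k) = 1"
    using unit v by (simp add: scalar_prod_def atLeast0LessThan)
  have "s = (\<Sum>k<n. (if k = 0 then 1 - 2 * v $ 0 else 0) + v $ k * v $ k)"
    unfolding s_def by (rule sum.cong) (auto simp: u_def algebra_simps)
  also have "\<dots> = 2 - 2 * v $ 0"
    using n by (simp add: sum.distrib vv)
  finally have s: "s = 2 - 2 * v $ 0" .
  have ccs: "c * c * s = 2 * c" by (simp add: c_def)
  have "W * W = 1\<^sub>m n"
  proof (rule eq_matI)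
    fix i j assume ij: "i < dim_row (1\<^sub>m n)" "j < dim_col (1\<^sub>m n)"
    have "(W * W) $$ (i, j) = (\<Sum>k<n. ((if i = k then 1 else 0) - c * u i * u k) * ((if k = j then 1 else 0) - c * u k * u j))"
      using ij by (simp add: W_def scalar_prod_def atLeast0LessThan)
    also have "\<dots> = (\<Sum>k<n. (if i = k then (if k = j then 1 else 0) - c * u k * u j else 0)
        - (if k = j then c * u i * u k else 0) + c * c * u i * u j * (u k * u k))"
      by (rule sum.cong) (auto simp: algebra_simps)
    also have "\<dots> = (if i = j then 1 else 0) - 2 * c * u i * u j + c * c * s * u i * u j"
      using ij by (simp add: sum.distrib sum_subtractf s_def flip: sum_distrib_left)
    also have "\<dots> = 1\<^sub>m n $$ (i, j)" using ij by (simp add: ccs)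
    finally show "(W * W) $$ (i, j) = 1\<^sub>m n $$ (i, j)" .
  qed (simp_all add: W_def)
  moreover have "transpose_mat W = W"
    by (rule eq_matI) (auto simp: W_def)
  moreover have "W *\<^sub>v unit_vec n 0 = v"
  proof (rule eq_vecI)
    fix i assume i: "i < dim_vec v"
    have cu: "c * u i * u 0 = u i"
    proof (cases "s = 0")
      case True
      then have "\<forall>k\<in>{..<n}. u k * u k = 0"
        unfolding s_def by (subst sum_nonneg_eq_0_iff[symmetric]) auto
      then show ?thesis using i v by simp
    next
      case False
      have "c * u 0 = 1" using False s by (simp add: c_def u_def)
      then show ?thesis by (metis mult.assoc mult.commute mult.right_neutral)
    qed
    have "(W *\<^sub>v unit_vec n 0) $ i = W $$ (i, 0)"
      using i v n W by simp
    also have "\<dots> = v $ i" using i v n cu by (auto simp: W_def u_def)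
    finally show "(W *\<^sub>v unit_vec n 0) $ i = v $ i" .
  qed (use v W in auto)
  ultimately show ?thesis using W that by blast
qed

text \<open>A reflection moves a unit eigenvector to the first unit vector. By symmetry the transformed matrix is
  then block diagonal, and the lower block is symmetric with the remaining eigenvalues. That the
  characteristic polynomial splits is what provides the eigenvector at each stage.\<close>

theorem symmetric_orthogonal_diagonalization:
  fixes M :: "real mat"
  assumes "M \<in> carrier_mat n n" "transpose_mat M = M"
    and "char_poly M = (\<Prod>e\<leftarrow>es. [:- e, 1:])"
  shows "\<exists>P \<in> carrier_mat n n. transpose_mat P * P = 1\<^sub>m n \<and> P * transpose_mat P = 1\<^sub>m n \<and>
    transpose_mat P * M * P = mat_diag n (\<lambda>i. es ! i)"
  using assms
proof (induction es arbitrary: n M)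
  case Nil
  then have "n = 0" using degree_monic_char_poly[of M n] by simp
  then show ?case using Nil by (intro bexI[of _ "1\<^sub>m n"]) (auto simp: mat_diag_def)
next
  case (Cons e es)
  note M = Cons.prems(1)
  have "poly (char_poly M) e = 0" by (simp add: Cons.prems(3))
  then have "eigenvalue M e" using eigenvalue_root_char_poly[OF M] by simp
  then obtain w where w: "w \<in> carrier_vec n" "w \<noteq> 0\<^sub>v n" "M *\<^sub>v w = e \<cdot>\<^sub>v w"
    using M unfolding eigenvalue_def eigenvector_def by auto
  have ww: "w \<bullet> w > 0"
    using w(1,2) conjugate_square_greater_0_vec[of w n] by simp
  define v where "v = (1 / sqrt (w \<bullet> w)) \<cdot>\<^sub>v w"
  have v: "v \<in> carrier_vec n" by (simp add: v_def w)
  have vv: "v \<bullet> v = 1"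
    using ww w(1) by (simp add: v_def field_simps)
  have Mv: "M *\<^sub>v v = e \<cdot>\<^sub>v v"
    using M w by (simp add: v_def mult_mat_vec smult_smult_assoc mult.commute)
  have "n \<noteq> 0" using w by auto
  then obtain m where n: "n = Suc m" using not0_implies_Suc by blast
  obtain W where W: "W \<in> carrier_mat n n" "transpose_mat W = W" "W * W = 1\<^sub>m n"
    "W *\<^sub>v unit_vec n 0 = v"
    using householder_reflection[OF v _ vv] n by blast
  let ?e = "unit_vec n 0 :: real vec"
  have Wv: "W *\<^sub>v v = ?e"
    using W assoc_mult_mat_vec[of W n n W n ?e] by simp
  define M' where "M' = W * M * W"
  have M': "M' \<in> carrier_mat n n" using W M by (simp add: M'_def)
  have M'sym: "transpose_mat M' = M'"
    using W M Cons.prems(2) by (simp add: M'_def transpose_mult[of _ n n _ n] assoc_mult_mat[of _ n n _ n _ n])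
  have "M' *\<^sub>v ?e = e \<cdot>\<^sub>v ?e"
    using W M v Mv Wv by (simp add: M'_def assoc_mult_mat_vec[of _ n n _ n] mult_mat_vec)
  moreover have "M' *\<^sub>v ?e = col M' 0"
    using M' n by (intro eq_vecI) auto
  ultimately have "col M' 0 $ i = (e \<cdot>\<^sub>v ?e) $ i" for i by simp
  then have col0: "M' $$ (i, 0) = (if i = 0 then e else 0)" if "i < n" for i
    using M' n that by (metis (no_types, lifting) carrier_matD(1) carrier_matD(2) index_col index_smult_vec(1)
      index_unit_vec(1) index_unit_vec(3) mult.right_neutral mult_zero_right zero_less_Suc)
  have row0: "M' $$ (0, i) = (if i = 0 then e else 0)" if "i < n" for i
    using col0[OF that] M' n that M'sym by (metis carrier_matD index_transpose_mat(1) zero_less_Suc)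
  define S where "S = mat m m (\<lambda>(i, j). M' $$ (Suc i, Suc j))"
  have S: "S \<in> carrier_mat m m" by (simp add: S_def)
  let ?a = "mat 1 1 (\<lambda>_. e)"
  have blk: "M' = four_block_mat ?a (0\<^sub>m 1 m) (0\<^sub>m m 1) S"
    using M' n by (intro eq_matI) (auto simp: S_def col0 row0)
  have "similar_mat M' M"
    using W M unfolding similar_mat_def similar_mat_wit_def Let_def
    by (intro exI[of _ W]) (simp add: M'_def)
  then have "char_poly M' = char_poly M" by (rule char_poly_similar)
  moreover have "char_poly M' = char_poly ?a * char_poly S"
    unfolding blk by (rule char_poly_four_block_zeros_col) (auto simp: S)
  moreover have "char_poly ?a = [:- e, 1:]"
    by (subst char_poly_upper_triangular) (auto simp: diag_mat_def)
  ultimately have cpS: "char_poly S = (\<Prod>e\<leftarrow>es. [:- e, 1:])"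
    using Cons.prems(3) mult_left_cancel[of "[:- e, 1:]"] by (metis (no_types, lifting) list.simps(9) pCons_eq_0_iff prod_list.Cons one_neq_zero)
  have "transpose_mat S = S"
  proof (rule eq_matI)
    fix i j assume "i < dim_row S" "j < dim_col S"
    then show "transpose_mat S $$ (i, j) = S $$ (i, j)"
      using M' M'sym n by (simp add: S_def) (metis Suc_less_eq carrier_matD index_transpose_mat(1))
  qed (simp_all add: S_def)
  from Cons.IH[OF S this cpS] obtain P where P: "P \<in> carrier_mat m m"
    "transpose_mat P * P = 1\<^sub>m m" "P * transpose_mat P = 1\<^sub>m m" "transpose_mat P * S * P = mat_diag m (\<lambda>i. es ! i)"
    by blast
  define F where "F = four_block_mat (1\<^sub>m 1) (0\<^sub>m 1 m) (0\<^sub>m m 1) P"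
  define F' where "F' = four_block_mat (1\<^sub>m 1) (0\<^sub>m 1 m) (0\<^sub>m m 1) (transpose_mat P)"
  have F: "F \<in> carrier_mat n n" "F' \<in> carrier_mat n n"
    using P n by (auto simp: F_def F'_def)
  have tF: "transpose_mat F = F'"
    using P by (simp add: F_def F'_def transpose_four_block_mat[of _ 1 1 _ m _ m])
  note mult_blk = mult_four_block_mat[of _ 1 1 _ m _ m _ _ 1 _ m]
  have FF: "F' * F = 1\<^sub>m n" "F * F' = 1\<^sub>m n"
    using P n by (simp_all add: F_def F'_def mult_blk)
  have "F' * M' * F = four_block_mat ?a (0\<^sub>m 1 m) (0\<^sub>m m 1) (mat_diag m (\<lambda>i. es ! i))"
    using P S unfolding F_def F'_def blk by (simp add: mult_blk)
  also have "\<dots> = mat_diag n (\<lambda>i. (e # es) ! i)"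
    using n by (intro eq_matI) (auto simp: mat_diag_def)
  finally have diag: "F' * M' * F = mat_diag n (\<lambda>i. (e # es) ! i)" .
  show ?case
  proof (intro bexI[of _ "W * F"] conjI)
    have tWF: "transpose_mat (W * F) = F' * W"
      using W F tF by (simp add: transpose_mult[of _ n n _ n])
    note assoc = assoc_mult_mat[of _ n n _ n _ n]
    have WW: "W * (W * X) = X" "F * (F' * X) = X" "F' * (F * X) = X" if "X \<in> carrier_mat n n" for X
      using W F FF that by (simp_all flip: assoc)
    show "W * F \<in> carrier_mat n n" using W F by simp
    show "transpose_mat (W * F) * (W * F) = 1\<^sub>m n" "W * F * transpose_mat (W * F) = 1\<^sub>m n"
      unfolding tWF using W F WW FF by (simp_all add: assoc)
    show "transpose_mat (W * F) * M * (W * F) = mat_diag n (\<lambda>i. (e # es) ! i)"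
      unfolding tWF diag[symmetric] M'_def using W F M by (simp add: assoc)
  qed
qed

lemma prod_linear_factors_proots:
  fixes p :: "'a :: field poly"
  assumes "p \<noteq> 0" "size (proots p) = degree p"
  shows "p = Polynomial.smult (lead_coeff p) (\<Prod>a\<in>#proots p. [:- a, 1:])"
  using assms
proof (induction "degree p" arbitrary: p)
  case 0
  then show ?case by (auto elim: degree_eq_zeroE)
next
  case (Suc n)
  then have "proots p \<noteq> {#}" by auto
  then obtain a where "a \<in># proots p" by blast
  then have "poly p a = 0" using Suc.prems(1) by simp
  then obtain q where p: "p = [:- a, 1:] * q" by (auto simp: poly_eq_0_iff_dvd)
  have q: "q \<noteq> 0" using p Suc.prems(1) by auto
  have roots: "proots p = {#a#} + proots q"
    unfolding p by (subst proots_mult) (use q in auto)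
  have deg: "degree p = Suc (degree q)"
    unfolding p by (subst degree_mult_eq) (use q in auto)
  have "q = Polynomial.smult (lead_coeff q) (\<Prod>a\<in>#proots q. [:- a, 1:])"
    using Suc.hyps q Suc.prems deg roots by auto
  moreover have "lead_coeff p = lead_coeff q"
    unfolding p lead_coeff_mult by simp
  ultimately have "[:- a, 1:] * q = [:- a, 1:] * Polynomial.smult (lead_coeff p) (\<Prod>a\<in>#proots q. [:- a, 1:])"
    by metis
  then show ?case
    unfolding roots by (simp add: p[symmetric] del: mult_pCons_left)
qed

lemma mat_diag_mult_vec:
  fixes v :: "'a :: comm_semiring_1 vec"
  assumes "v \<in> carrier_vec n" "k < n"
  shows "(mat_diag n f *\<^sub>v v) $ k = f k * v $ k"
proof -
  have "(mat_diag n f *\<^sub>v v) $ k = (\<Sum>j<n. (if k = j then f j else 0) * v $ j)"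
    using assms by (simp add: mat_diag_def scalar_prod_def atLeast0LessThan)
  also have "\<dots> = (\<Sum>j<n. if k = j then f j * v $ j else 0)"
    by (rule sum.cong) auto
  finally show ?thesis using assms(2) by simp
qed

text \<open>The three counts in the signature add up to the size of the matrix, so the characteristic
  polynomial splits over the reals. Scaling an orthonormal basis of eigenvectors by the square roots of the
  absolute values of the eigenvalues, the positive one first, brings the form to the Lorentz form.\<close>

theorem lorentz_coordinates:
  fixes M :: "real mat"
  assumes M: "M \<in> carrier_mat r r" and sym: "transpose_mat M = M"
    and sig: "matrix_signature M = (1, 0, r - 1)"
  obtains C D where "C \<in> carrier_mat r r" "D \<in> carrier_mat r r" "C * D = 1\<^sub>m r" "D * C = 1\<^sub>m r" "0 < r"
    "\<And>x y. x \<in> carrier_vec r \<Longrightarrow> y \<in> carrier_vec r \<Longrightarrow>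
      x \<bullet> (M *\<^sub>v y) = (C *\<^sub>v x) $ 0 * (C *\<^sub>v y) $ 0 - (\<Sum>k = 1..<r. (C *\<^sub>v x) $ k * (C *\<^sub>v y) $ k)"
proof -
  define E where "E = proots (char_poly M)"
  have deg: "degree (char_poly M) = r" "lead_coeff (char_poly M) = 1"
    using degree_monic_char_poly[OF M] by auto
  then have nz: "char_poly M \<noteq> 0" by auto
  have E1: "size {#a \<in># E. a > 0#} = 1" "{#a \<in># E. a = 0#} = {#}" "size {#a \<in># E. a < 0#} = r - 1"
    using sig by (auto simp: matrix_signature_def Let_def E_def)
  have E2: "E = {#a \<in># E. a > 0#} + {#a \<in># E. a < 0#}"
  proof (rule multiset_eqI)
    fix a
    have "count {#a \<in># E. a = 0#} a = 0" unfolding E1 by simp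
    then show "count E a = count ({#a \<in># E. a > 0#} + {#a \<in># E. a < 0#}) a"
      by (cases a "0::real" rule: linorder_cases) auto
  qed
  obtain p where p: "{#a \<in># E. a > 0#} = {#p#}" using E1(1) size_1_singleton_mset by blast
  have p0: "p > 0" using p by (metis (mono_tags, lifting) filter_mset_eq_conv multi_member_last)
  obtain ns where ns: "mset ns = {#a \<in># E. a < 0#}" using ex_mset by blast
  define es where "es = p # ns"
  have "length ns = r - 1" using ns E1(3) by (metis size_mset)
  have sizeE: "size E = Suc (length ns)"
    by (subst E2) (simp add: p flip: ns)
  have "size E \<le> r" using size_proots_le[of "char_poly M"] deg by (simp add: E_def)
  then have r: "0 < r" "length es = r"
    using sizeE \<open>length ns = r - 1\<close> by (auto simp: es_def)
  have mes: "mset es = E" using E2 by (simp add: es_def p ns)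
  have "char_poly M = (\<Prod>a\<in>#E. [:- a, 1:])"
    using prod_linear_factors_proots[OF nz] deg sizeE r by (simp add: E_def es_def)
  also have "\<dots> = (\<Prod>e\<leftarrow>es. [:- e, 1:])"
    by (metis mes mset_map prod_mset_prod_list)
  finally have cp: "char_poly M = (\<Prod>e\<leftarrow>es. [:- e, 1:])" .
  have neg: "es ! k < 0" if "k \<in> {1..<r}" for k
  proof -
    have "es ! k \<in> set ns" using that r by (auto simp: es_def nth_Cons split: nat.split)
    also have "set ns = set_mset {#a \<in># E. a < 0#}" using ns by (metis set_mset_mset)
    finally show ?thesis by simp
  qed
  obtain P where P: "P \<in> carrier_mat r r" "transpose_mat P * P = 1\<^sub>m r" "P * transpose_mat P = 1\<^sub>m r"
     "transpose_mat P * M * P = mat_diag r (\<lambda>i. es ! i)"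
    using symmetric_orthogonal_diagonalization[OF M sym cp] by blast
  define w where "w k = sqrt \<bar>es ! k\<bar>" for k
  have nz: "es ! k \<noteq> 0" if "k < r" for k
    using neg[of k] p0 that by (cases k) (auto simp: es_def)
  define C where "C = mat_diag r w * transpose_mat P"
  define D where "D = P * mat_diag r (\<lambda>k. 1 / w k)"
  note assoc = assoc_mult_mat[of _ r r _ r _ r]
  have ww: "mat_diag r (\<lambda>i. w i * (1 / w i)) = 1\<^sub>m r" "mat_diag r (\<lambda>i. (1 / w i) * w i) = 1\<^sub>m r"
    using nz by (auto intro!: eq_matI simp: mat_diag_def w_def)
  have C: "C \<in> carrier_mat r r" and D: "D \<in> carrier_mat r r"
    using P by (auto simp: C_def D_def intro!: mult_carrier_mat)
  let ?w' = "mat_diag r (\<lambda>k. 1 / w k)"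
  have cancel: "transpose_mat P * (P * X) = X" "?w' * (mat_diag r w * X) = X" if "X \<in> carrier_mat r r" for X
  proof -
    show "transpose_mat P * (P * X) = X"
      using P(1,2) that assoc[of "transpose_mat P" P X] by simp
    show "?w' * (mat_diag r w * X) = X"
      using ww(2) that assoc[of ?w' "mat_diag r w" X] by simp
  qed
  have "C * D = mat_diag r w * (transpose_mat P * (P * ?w'))"
    using P(1) C D unfolding C_def D_def by (intro assoc) auto
  then have CD: "C * D = 1\<^sub>m r" using ww(1) cancel(1)[of ?w'] by simp
  have "D * C = P * (?w' * (mat_diag r w * transpose_mat P))"
    using P(1) C D unfolding C_def D_def by (intro assoc) auto
  then have DC: "D * C = 1\<^sub>m r" using P(1,3) cancel(2)[of "transpose_mat P"] by simp
  have form: "x \<bullet> (M *\<^sub>v y) = (C *\<^sub>v x) $ 0 * (C *\<^sub>v y) $ 0 - (\<Sum>k = 1..<r. (C *\<^sub>v x) $ k * (C *\<^sub>v y) $ k)"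
    if x: "x \<in> carrier_vec r" and y: "y \<in> carrier_vec r" for x y
  proof -
    define x' where "x' = transpose_mat P *\<^sub>v x"
    define y' where "y' = transpose_mat P *\<^sub>v y"
    have x': "x' \<in> carrier_vec r" and y': "y' \<in> carrier_vec r" using P x y by (auto simp: x'_def y'_def)
    have xP: "P *\<^sub>v x' = x" "P *\<^sub>v y' = y"
      using P x y unfolding x'_def y'_def by (simp_all flip: assoc_mult_mat_vec[of _ r r _ r])
    have Cx: "(C *\<^sub>v z) $ k = w k * (transpose_mat P *\<^sub>v z) $ k" if "z \<in> carrier_vec r" "k < r" for z k
    proof -
      have "C *\<^sub>v z = mat_diag r w *\<^sub>v (transpose_mat P *\<^sub>v z)"
        using P that unfolding C_def by (simp add: assoc_mult_mat_vec[of _ r r _ r])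
      also have "\<dots> $ k = w k * (transpose_mat P *\<^sub>v z) $ k"
        using that P(1) by (intro mat_diag_mult_vec) auto
      finally show ?thesis .
    qed
    have "x \<bullet> (M *\<^sub>v y) = (P *\<^sub>v x') \<bullet> (M *\<^sub>v (P *\<^sub>v y'))" by (simp add: xP)
    also have "\<dots> = x' \<bullet> (transpose_mat P *\<^sub>v (M *\<^sub>v (P *\<^sub>v y')))"
      using transpose_vec_mult_scalar[of "transpose_mat P" r r "M *\<^sub>v (P *\<^sub>v y')" x'] P M x' y' by simp
    also have "\<dots> = x' \<bullet> (mat_diag r (\<lambda>i. es ! i) *\<^sub>v y')"
      unfolding P(4)[symmetric] using P(1) M y' by (simp add: assoc_mult_mat_vec[of _ r r _ r])
    also have "\<dots> = (\<Sum>k<r. x' $ k * (es ! k * y' $ k))"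
    proof -
      have "(mat_diag r (\<lambda>i. es ! i) *\<^sub>v y') $ k = es ! k * y' $ k" if "k < r" for k
        using that y' by (rule mat_diag_mult_vec[rotated])
      then show ?thesis using y' by (simp add: scalar_prod_def atLeast0LessThan mat_diag_def)
    qed
    also have "\<dots> = x' $ 0 * (es ! 0 * y' $ 0) + (\<Sum>k = 1..<r. x' $ k * (es ! k * y' $ k))"
      using sum.atLeast_Suc_lessThan[OF r(1), of "\<lambda>k. x' $ k * (es ! k * y' $ k)"] by (simp add: atLeast0LessThan)
    also have "x' $ 0 * (es ! 0 * y' $ 0) = (C *\<^sub>v x) $ 0 * (C *\<^sub>v y) $ 0"
      using p0 by (simp add: Cx r x y w_def es_def flip: x'_def y'_def)
    also have "(\<Sum>k = 1..<r. x' $ k * (es ! k * y' $ k)) = - (\<Sum>k = 1..<r. (C *\<^sub>v x) $ k * (C *\<^sub>v y) $ k)"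
      unfolding sum_negf[symmetric]
    proof (rule sum.cong)
      fix k assume k: "k \<in> {1..<r}"
      then have es: "es ! k = - (w k * w k)" using neg[OF k] by (simp add: w_def)
      have "(C *\<^sub>v x) $ k = w k * x' $ k" "(C *\<^sub>v y) $ k = w k * y' $ k"
        using k Cx x y by (auto simp: x'_def y'_def)
      then show "x' $ k * (es ! k * y' $ k) = - ((C *\<^sub>v x) $ k * (C *\<^sub>v y) $ k)"
        by (simp add: es)
    qed simp
    finally show ?thesis by simp
  qed
  show ?thesis by (rule that[OF C D CD DC r(1) form])
qed

section \<open>Lorentz forms\<close>

locale lorentz_form =
  fixes r :: nat and M :: "real mat"
  assumes M_carrier [simp]: "M \<in> carrier_mat r r"
    and M_sym: "transpose_mat M = M"
    and M_signature: "matrix_signature M = (1, 0, r - 1)"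
begin

abbreviation V :: "real vec set" where "V \<equiv> carrier_vec r"

definition bil :: "real vec \<Rightarrow> real vec \<Rightarrow> real" where
  "bil x y = x \<bullet> (M *\<^sub>v y)"

lemma M_mult_carrier [simp]: "x \<in> V \<Longrightarrow> M *\<^sub>v x \<in> V"
  by (rule mult_mat_vec_carrier[OF M_carrier])

lemma bil_add_left: "x \<in> V \<Longrightarrow> y \<in> V \<Longrightarrow> z \<in> V \<Longrightarrow> bil (x + y) z = bil x z + bil y z"
  unfolding bil_def by (rule add_scalar_prod_distrib[where n = r]) auto

lemma bil_commute: "x \<in> V \<Longrightarrow> y \<in> V \<Longrightarrow> bil x y = bil y x"
  unfolding bil_def using transpose_vec_mult_scalar[OF M_carrier, of y x] M_sym
  by (metis M_carrier comm_scalar_prod mult_mat_vec_carrier)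

lemma bil_add_right: "x \<in> V \<Longrightarrow> y \<in> V \<Longrightarrow> z \<in> V \<Longrightarrow> bil z (x + y) = bil z x + bil z y"
  using bil_add_left[of x y z] bil_commute by (metis add_carrier_vec)

lemma bil_smult_left [simp]: "x \<in> V \<Longrightarrow> y \<in> V \<Longrightarrow> bil (a \<cdot>\<^sub>v x) y = a * bil x y"
  unfolding bil_def by (rule scalar_prod_smult_left) (simp add: mult_mat_vec_def M_carrier[THEN carrier_matD(1)])

lemma bil_smult_right [simp]: "x \<in> V \<Longrightarrow> y \<in> V \<Longrightarrow> bil x (a \<cdot>\<^sub>v y) = a * bil x y"
  using bil_smult_left[of y x a] bil_commute by (metis smult_carrier_vec)

lemma bil_minus_left: "x \<in> V \<Longrightarrow> y \<in> V \<Longrightarrow> z \<in> V \<Longrightarrow> bil (x - y) z = bil x z - bil y z"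
  unfolding bil_def by (rule minus_scalar_prod_distrib[where n = r]) auto

lemma bil_minus_right: "x \<in> V \<Longrightarrow> y \<in> V \<Longrightarrow> z \<in> V \<Longrightarrow> bil z (x - y) = bil z x - bil z y"
  using bil_minus_left[of x y z] bil_commute by (metis minus_carrier_vec)

lemmas bil_linear = bil_add_left bil_add_right bil_minus_left bil_minus_right

text \<open>Linear coordinates in which the form is \<open>x\<^sub>0 y\<^sub>0 - x\<^sub>1 y\<^sub>1 - \<dots> - x\<^bsub>r-1\<^esub> y\<^bsub>r-1\<^esub>\<close>:
  coordinate \<open>0\<close> is time, the others are space.\<close>

definition coord_mat :: "real mat" where
  "coord_mat = (SOME C. C \<in> carrier_mat r r \<and> (\<exists>D \<in> carrier_mat r r. C * D = 1\<^sub>m r \<and> D * C = 1\<^sub>m r) \<and>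
    (\<forall>x \<in> V. \<forall>y \<in> V. x \<bullet> (M *\<^sub>v y) =
      (C *\<^sub>v x) $ 0 * (C *\<^sub>v y) $ 0 - (\<Sum>k = 1..<r. (C *\<^sub>v x) $ k * (C *\<^sub>v y) $ k)))"

definition coord :: "real vec \<Rightarrow> nat \<Rightarrow> real" where
  "coord x k = (coord_mat *\<^sub>v x) $ k"

lemma rank_pos: "0 < r"
  by (rule lorentz_coordinates[OF M_carrier M_sym M_signature])

lemma coord_mat_props:
  shows coord_mat_carrier: "coord_mat \<in> carrier_mat r r"
    and coord_mat_inverse: "\<exists>D \<in> carrier_mat r r. coord_mat * D = 1\<^sub>m r \<and> D * coord_mat = 1\<^sub>m r"
    and bil_coord: "x \<in> V \<Longrightarrow> y \<in> V \<Longrightarrow>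
      bil x y = coord x 0 * coord y 0 - (\<Sum>k = 1..<r. coord x k * coord y k)"
proof -
  have "\<exists>C. C \<in> carrier_mat r r \<and> (\<exists>D \<in> carrier_mat r r. C * D = 1\<^sub>m r \<and> D * C = 1\<^sub>m r) \<and>
    (\<forall>x \<in> V. \<forall>y \<in> V. x \<bullet> (M *\<^sub>v y) =
      (C *\<^sub>v x) $ 0 * (C *\<^sub>v y) $ 0 - (\<Sum>k = 1..<r. (C *\<^sub>v x) $ k * (C *\<^sub>v y) $ k))"
    by (rule lorentz_coordinates[OF M_carrier M_sym M_signature]) blast
  from someI_ex[OF this] show "coord_mat \<in> carrier_mat r r"
    "\<exists>D \<in> carrier_mat r r. coord_mat * D = 1\<^sub>m r \<and> D * coord_mat = 1\<^sub>m r"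
    "x \<in> V \<Longrightarrow> y \<in> V \<Longrightarrow>
      bil x y = coord x 0 * coord y 0 - (\<Sum>k = 1..<r. coord x k * coord y k)"
    unfolding coord_mat_def[symmetric] coord_def bil_def by blast+
qed

lemma coord_add: "x \<in> V \<Longrightarrow> y \<in> V \<Longrightarrow> k < r \<Longrightarrow> coord (x + y) k = coord x k + coord y k"
  using coord_mat_carrier by (simp add: coord_def scalar_prod_add_distrib[of _ r])

lemma coord_smult: "x \<in> V \<Longrightarrow> k < r \<Longrightarrow> coord (a \<cdot>\<^sub>v x) k = a * coord x k"
  using coord_mat_carrier by (simp add: coord_def)

lemma entries_bounded_by_coords:
  obtains K where "\<And>x i R. x \<in> V \<Longrightarrow> i < r \<Longrightarrow> (\<And>k. k < r \<Longrightarrow> \<bar>coord x k\<bar> \<le> R) \<Longrightarrow> \<bar>x $ i\<bar> \<le> K * R"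
proof -
  obtain D where D: "D \<in> carrier_mat r r" "D * coord_mat = 1\<^sub>m r"
    using coord_mat_inverse by blast
  define K where "K = (\<Sum>i<r. \<Sum>k<r. \<bar>D $$ (i, k)\<bar>)"
  show ?thesis
  proof (rule that)
    fix x i R assume x: "x \<in> V" and i: "i < r" and R: "\<And>k. k < r \<Longrightarrow> \<bar>coord x k\<bar> \<le> R"
    have "x = D *\<^sub>v (coord_mat *\<^sub>v x)"
      using D x coord_mat_carrier by (simp flip: assoc_mult_mat_vec[of _ r r _ r])
    then have "x $ i = (D *\<^sub>v (coord_mat *\<^sub>v x)) $ i" by simp
    also have "\<dots> = (\<Sum>k<r. D $$ (i, k) * coord x k)"
      using D coord_mat_carrier x i by (simp add: scalar_prod_def atLeast0LessThan coord_def)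
    finally have "\<bar>x $ i\<bar> \<le> (\<Sum>k<r. \<bar>D $$ (i, k)\<bar> * \<bar>coord x k\<bar>)"
      by (metis (no_types, lifting) abs_mult sum.cong sum_abs)
    also have "\<dots> \<le> (\<Sum>k<r. \<bar>D $$ (i, k)\<bar> * R)"
      by (intro sum_mono mult_left_mono) (auto simp: R)
    also have "\<dots> = (\<Sum>k<r. \<bar>D $$ (i, k)\<bar>) * R"
      by (simp add: sum_distrib_right)
    also have "\<dots> \<le> K * R"
    proof (rule mult_right_mono)
      show "(\<Sum>k<r. \<bar>D $$ (i, k)\<bar>) \<le> K"
        unfolding K_def using i by (intro member_le_sum[of i "{..<r}" "\<lambda>i. \<Sum>k<r. \<bar>D $$ (i, k)\<bar>"]) (auto intro: sum_nonneg)
      show "0 \<le> R" using R[OF rank_pos] by linarith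
    qed
    finally show "\<bar>x $ i\<bar> \<le> K * R" .
  qed
qed

lemma zero_of_coords_zero:
  assumes "x \<in> V" "\<And>k. k < r \<Longrightarrow> coord x k = 0"
  shows "x = 0\<^sub>v r"
proof -
  obtain K where "\<bar>x $ i\<bar> \<le> K * 0" if "i < r" for i
    using entries_bounded_by_coords assms by (metis abs_zero order_refl)
  then show ?thesis using assms(1) by (intro eq_vecI) auto
qed

lemma zero_of_time_zero:
  assumes x: "x \<in> V" "bil x x = 0" "coord x 0 = 0"
  shows "x = 0\<^sub>v r"
proof (rule zero_of_coords_zero[OF x(1)])
  have "(\<Sum>k = 1..<r. coord x k * coord x k) = 0"
    using bil_coord[OF x(1) x(1)] x by simp
  then have "\<forall>k\<in>{1..<r}. coord x k * coord x k = 0"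
    by (subst sum_nonneg_eq_0_iff[symmetric]) auto
  then show "coord x k = 0" if "k < r" for k using x that by (cases "k = 0") auto
qed

lemma time_vector:
  obtains y where "y \<in> V" "coord y 0 = 1" "\<And>k. k \<in> {1..<r} \<Longrightarrow> coord y k = 0"
proof -
  obtain D where D: "D \<in> carrier_mat r r" "coord_mat * D = 1\<^sub>m r"
    using coord_mat_inverse by blast
  have "coord_mat *\<^sub>v (D *\<^sub>v unit_vec r 0) = unit_vec r 0"
    using D coord_mat_carrier by (simp flip: assoc_mult_mat_vec[of _ r r _ r])
  then show ?thesis
    by (intro that[of "D *\<^sub>v unit_vec r 0"]) (use D rank_pos in \<open>auto simp: coord_def\<close>)
qed

lemma positive_vector_exists: obtains y where "y \<in> V" "bil y y > 0"
proof -
  obtain y where y: "y \<in> V" "coord y 0 = 1" "\<And>k. k \<in> {1..<r} \<Longrightarrow> coord y k = 0"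
    using time_vector by blast
  have "bil y y = 1" using bil_coord[OF y(1) y(1)] y by simp
  then show ?thesis using that y(1) by simp
qed

lemma bil_nondegenerate:
  assumes "\<And>y. y \<in> V \<Longrightarrow> bil x y = 0" and x: "x \<in> V"
  shows "x = 0\<^sub>v r"
proof -
  obtain y where y: "y \<in> V" "coord y 0 = 1" "\<And>k. k \<in> {1..<r} \<Longrightarrow> coord y k = 0"
    using time_vector by blast
  have "coord x 0 = 0" using assms(1)[OF y(1)] bil_coord[OF x y(1)] y by simp
  then show ?thesis using zero_of_time_zero x assms(1) by blast
qed

text \<open>For a positive vector \<open>y\<close> the space part is strictly shorter than the time coordinate. By
  Cauchy-Schwarz, a vector \<open>w\<close> of bounded norm with a large time coordinate therefore pairs with
  \<open>y\<close> to a large value; so if the pairing is bounded, the time coordinate of \<open>w\<close> is, and then its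
  space part as well.\<close>

lemma bounded_of_time_and_norm:
  assumes y: "y \<in> V" "bil y y > 0"
  obtains R where "\<And>w i. w \<in> V \<Longrightarrow> \<bar>bil w y\<bar> \<le> A \<Longrightarrow> \<bar>bil w w\<bar> \<le> b \<Longrightarrow> i < r \<Longrightarrow> \<bar>w $ i\<bar> \<le> R"
proof -
  obtain K where K: "\<And>x i R. x \<in> V \<Longrightarrow> i < r \<Longrightarrow> (\<And>k. k < r \<Longrightarrow> \<bar>coord x k\<bar> \<le> R) \<Longrightarrow> \<bar>x $ i\<bar> \<le> K * R"
    using entries_bounded_by_coords by blast
  define S where "S w = L2_set (coord w) {1..<r}" for w
  have S2: "(S w)\<^sup>2 = (coord w 0)\<^sup>2 - bil w w" if "w \<in> V" for w
    using bil_coord[OF that that] by (simp add: S_def L2_set_def sum_nonneg power2_eq_square)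
  have S0: "0 \<le> S w" for w by (simp add: S_def)
  have T: "S y < \<bar>coord y 0\<bar>"
    using S2[OF y(1)] y(2) by (intro power_less_imp_less_base[of "S y" 2]) auto
  define R where "R = (A + S y * sqrt b) / (\<bar>coord y 0\<bar> - S y) + sqrt b"
  show ?thesis
  proof (rule that)
    fix w i assume w: "w \<in> V" "\<bar>bil w y\<bar> \<le> A" "\<bar>bil w w\<bar> \<le> b" and i: "i < r"
    have b: "b \<ge> 0" using w(3) by linarith
    have "(S w)\<^sup>2 \<le> (\<bar>coord w 0\<bar> + sqrt b)\<^sup>2"
      using S2[OF w(1)] w(3) b by (simp add: power2_sum add_increasing2)
    then have Sw: "S w \<le> \<bar>coord w 0\<bar> + sqrt b" by (rule power2_le_imp_le) (simp add: b)
    have "\<bar>\<Sum>k = 1..<r. coord w k * coord y k\<bar> \<le> (\<Sum>k = 1..<r. \<bar>coord w k\<bar> * \<bar>coord y k\<bar>)"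
      by (metis (no_types, lifting) abs_mult sum.cong sum_abs)
    also have "\<dots> \<le> S w * S y" unfolding S_def by (rule L2_set_mult_ineq)
    also have "\<dots> \<le> (\<bar>coord w 0\<bar> + sqrt b) * S y" by (rule mult_right_mono[OF Sw S0])
    finally have "\<bar>coord w 0 * coord y 0\<bar> \<le> A + (\<bar>coord w 0\<bar> + sqrt b) * S y"
      using bil_coord[OF w(1) y(1)] w(2) by linarith
    then have "\<bar>coord w 0\<bar> * (\<bar>coord y 0\<bar> - S y) \<le> A + S y * sqrt b"
      by (simp add: abs_mult algebra_simps)
    then have "\<bar>coord w 0\<bar> \<le> (A + S y * sqrt b) / (\<bar>coord y 0\<bar> - S y)"
      using T by (simp add: pos_le_divide_eq)
    then have R: "\<bar>coord w 0\<bar> + sqrt b \<le> R" by (simp add: R_def)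
    have "\<bar>coord w k\<bar> \<le> R" if "k < r" for k
    proof (cases "k = 0")
      case True
      then show ?thesis using R b by (smt (verit) real_sqrt_ge_0_iff)
    next
      case False
      then have "\<bar>coord w k\<bar> \<le> S w"
        unfolding S_def L2_set_def using that
        by (intro real_le_rsqrt) (auto intro!: member_le_sum[of k _ "\<lambda>k. (coord w k)\<^sup>2"])
      then show ?thesis using Sw R by linarith
    qed
    then show "\<bar>w $ i\<bar> \<le> K * R" using K[OF w(1) i] by blast
  qed
qed

text \<open>The combination of \<open>e\<close> and \<open>f\<close> with time coordinate \<open>0\<close> is again isotropic, so its space part has
  length \<open>0\<close>.\<close>

lemma isotropic_orthogonal_proportional:
  assumes e: "e \<in> V" "e \<noteq> 0\<^sub>v r" "bil e e = 0" and f: "f \<in> V" "bil f f = 0" and ef: "bil e f = 0"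
  obtains a where "f = a \<cdot>\<^sub>v e"
proof -
  note zero = zero_of_time_zero and r = rank_pos
  have ce: "coord e 0 \<noteq> 0" using zero[OF e(1,3)] e(2) by blast
  define a where "a = coord f 0 / coord e 0"
  have "f + (- a) \<cdot>\<^sub>v e = 0\<^sub>v r"
  proof (rule zero)
    show "coord (f + (- a) \<cdot>\<^sub>v e) 0 = 0" using ce e(1) f(1) r by (simp add: coord_add coord_smult a_def)
    show "bil (f + (- a) \<cdot>\<^sub>v e) (f + (- a) \<cdot>\<^sub>v e) = 0"
      using e(1,3) f ef bil_commute[OF f(1) e(1)] by (simp add: bil_linear)
    show "f + (- a) \<cdot>\<^sub>v e \<in> V" using e(1) f(1) by simp
  qed
  then have "(f + (- a) \<cdot>\<^sub>v e) $ i = 0" if "i < r" for i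
    using that by simp
  then have "f = a \<cdot>\<^sub>v e"
    using e(1) f(1) by (intro eq_vecI) auto
  then show ?thesis by (rule that)
qed

text \<open>On the complement of an isotropic vector \<open>v\<close>, moving along \<open>v\<close> to the hyperplane of time \<open>0\<close>
  does not change the form, which is minus a Euclidean inner product there. This is the
  Cauchy-Schwarz inequality for that inner product.\<close>

lemma isotropic_orthogonal_complement:
  assumes v: "v \<in> V" "v \<noteq> 0\<^sub>v r" "bil v v = 0"
    and x: "x \<in> V" "bil x v = 0" and y: "y \<in> V" "bil y v = 0"
  shows "(bil x y)\<^sup>2 \<le> bil x x * bil y y"
proof -
  note r = rank_pos
  have cv: "coord v 0 \<noteq> 0" using zero_of_time_zero[OF v(1,3)] v(2) by blast
  define pr where "pr z = z + (- coord z 0 / coord v 0) \<cdot>\<^sub>v v" for z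
  have pr: "pr z \<in> V" "coord (pr z) 0 = 0" if "z \<in> V" for z
    using that v(1) r cv by (simp_all add: pr_def coord_add coord_smult)
  have bpr: "bil (pr z) (pr z') = bil z z'" if "z \<in> V" "z' \<in> V" "bil z v = 0" "bil z' v = 0" for z z'
    using that v(1,3) bil_commute[OF v(1) that(1)] bil_commute[OF v(1) that(2)] by (simp add: pr_def bil_linear)
  have eq: "bil (pr z) (pr z') = - (\<Sum>k = 1..<r. coord (pr z) k * coord (pr z') k)" if "z \<in> V" "z' \<in> V" for z z'
    using bil_coord[of "pr z" "pr z'"] pr that by simp
  have L: "bil z z = - (L2_set (coord (pr z)) {1..<r})\<^sup>2" if "z \<in> V" "bil z v = 0" for z
    using bpr[OF that(1,1,2,2)] eq[OF that(1,1)] by (simp add: L2_set_def sum_nonneg power2_eq_square)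
  have "\<bar>bil x y\<bar> \<le> (\<Sum>k = 1..<r. \<bar>coord (pr x) k\<bar> * \<bar>coord (pr y) k\<bar>)"
    using bpr[OF x(1) y(1) x(2) y(2)] eq[OF x(1) y(1)] by (metis (no_types, lifting) abs_minus_cancel abs_mult sum.cong sum_abs)
  also have "\<dots> \<le> L2_set (coord (pr x)) {1..<r} * L2_set (coord (pr y)) {1..<r}"
    by (rule L2_set_mult_ineq)
  finally have "\<bar>bil x y\<bar>\<^sup>2 \<le> (L2_set (coord (pr x)) {1..<r} * L2_set (coord (pr y)) {1..<r})\<^sup>2"
    by (intro power_mono) auto
  then show ?thesis by (simp add: L x y power_mult_distrib)
qed

end

section \<open>Discreteness of integral isometries\<close>

lemma finite_bounded_integer_matrices:
  "finite {A \<in> carrier_mat m n. \<forall>i<m. \<forall>j<n. A $$ (i, j) \<in> \<int> \<and> \<bar>A $$ (i, j) :: real\<bar> \<le> R}"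
proof (rule finite_subset)
  let ?F = "PiE ({..<m} \<times> {..<n}) (\<lambda>_. {k \<in> \<int>. \<bar>k :: real\<bar> \<le> R})"
  show "finite (mat m n ` ?F)"
    by (intro finite_imageI finite_PiE) (auto simp: finite_abs_int_segment)
  show "{A \<in> carrier_mat m n. \<forall>i<m. \<forall>j<n. A $$ (i, j) \<in> \<int> \<and> \<bar>A $$ (i, j)\<bar> \<le> R} \<subseteq> mat m n ` ?F"
  proof
    fix A assume A: "A \<in> {A \<in> carrier_mat m n. \<forall>i<m. \<forall>j<n. A $$ (i, j) \<in> \<int> \<and> \<bar>A $$ (i, j)\<bar> \<le> R}"
    then have "A = mat m n (restrict (\<lambda>p. A $$ p) ({..<m} \<times> {..<n}))"
      by (intro eq_matI) auto
    moreover have "restrict (\<lambda>p. A $$ p) ({..<m} \<times> {..<n}) \<in> ?F"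
      using A by auto
    ultimately show "A \<in> mat m n ` ?F" by (rule image_eqI)
  qed
qed

lemma coordinatewise_convergent_subsequence:
  fixes u :: "nat \<Rightarrow> nat \<Rightarrow> real"
  assumes "\<And>k i. i < n \<Longrightarrow> \<bar>u k i\<bar> \<le> R"
  obtains s l where "strict_mono s" "\<And>i. i < n \<Longrightarrow> (\<lambda>k. u (s k) i) \<longlonglongrightarrow> l i"
  using assms
proof (induction n arbitrary: thesis)
  case 0
  show ?case by (rule 0(1)[of id]) (auto simp: strict_mono_def)
next
  case (Suc n)
  obtain s l where s: "strict_mono s" "\<And>i. i < n \<Longrightarrow> (\<lambda>k. u (s k) i) \<longlonglongrightarrow> l i"
    using Suc.IH Suc.prems(2) less_SucI by metis
  obtain t where t: "strict_mono t" "monoseq (\<lambda>k. u (s (t k)) n)"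
    using seq_monosub[of "\<lambda>k. u (s k) n"] by blast
  have "Bseq (\<lambda>k. u (s (t k)) n)"
    by (rule BseqI'[of _ R]) (use Suc.prems(2) in simp)
  then obtain L where L: "(\<lambda>k. u (s (t k)) n) \<longlonglongrightarrow> L"
    using Bseq_monoseq_convergent t(2) unfolding convergent_def by blast
  show ?case
  proof (rule Suc.prems(1))
    show "strict_mono (s \<circ> t)" using s t by (simp add: strict_mono_o)
    fix i assume "i < Suc n"
    then consider "i < n" | "i = n" by linarith
    then show "(\<lambda>k. u ((s \<circ> t) k) i) \<longlonglongrightarrow> (l(n := L)) i"
    proof cases
      case 1
      then show ?thesis using LIMSEQ_subseq_LIMSEQ[OF s(2)[OF 1] t(1)] by (simp add: o_def)
    qed (use L in auto)
  qed
qed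

lemma mult_mat_vec_sum:
  assumes "A \<in> carrier_mat m n" "x \<in> carrier_vec n" "i < m"
  shows "(A *\<^sub>v x) $ i = (\<Sum>j<n. A $$ (i, j) * x $ j)"
  using assms by (simp add: scalar_prod_def atLeast0LessThan)

text \<open>The group stays abstract and is represented faithfully by integral isometries. In this way, subgroups
  inherit all the assumptions with the same representation.\<close>

locale integral_lorentz_action = lorentz_form r M + group G
  for r :: nat and M :: "real mat" and G :: "('g, 'h) monoid_scheme" (structure) +
  fixes \<rho> :: "'g \<Rightarrow> real mat"
  assumes rho_carrier: "g \<in> carrier G \<Longrightarrow> \<rho> g \<in> carrier_mat r r"
    and rho_mult: "\<lbrakk>g \<in> carrier G; h \<in> carrier G\<rbrakk> \<Longrightarrow> \<rho> (g \<otimes> h) = \<rho> g * \<rho> h"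
    and rho_one: "\<rho> \<one> = 1\<^sub>m r"
    and rho_inj: "inj_on \<rho> (carrier G)"
    and rho_integral: "\<lbrakk>g \<in> carrier G; i < r; j < r\<rbrakk> \<Longrightarrow> \<rho> g $$ (i, j) \<in> \<int>"
    and M_integral: "\<lbrakk>i < r; j < r\<rbrakk> \<Longrightarrow> M $$ (i, j) \<in> \<int>"
    and rho_isometry: "\<lbrakk>g \<in> carrier G; x \<in> carrier_vec r; y \<in> carrier_vec r\<rbrakk>
      \<Longrightarrow> bil (\<rho> g *\<^sub>v x) (\<rho> g *\<^sub>v y) = bil x y"
begin

abbreviation act :: "'g \<Rightarrow> real vec \<Rightarrow> real vec" where
  "act g x \<equiv> \<rho> g *\<^sub>v x"

lemma act_carrier [simp]: "g \<in> carrier G \<Longrightarrow> x \<in> V \<Longrightarrow> act g x \<in> V"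
  using rho_carrier by (rule mult_mat_vec_carrier)

lemma act_mult: "g \<in> carrier G \<Longrightarrow> h \<in> carrier G \<Longrightarrow> x \<in> V \<Longrightarrow> act (g \<otimes> h) x = act g (act h x)"
  by (simp add: rho_mult assoc_mult_mat_vec[OF rho_carrier rho_carrier])

lemma act_one [simp]: "x \<in> V \<Longrightarrow> act \<one> x = x"
  by (simp add: rho_one)

lemma act_inv [simp]:
  "g \<in> carrier G \<Longrightarrow> x \<in> V \<Longrightarrow> act g (act (inv g) x) = x"
  "g \<in> carrier G \<Longrightarrow> x \<in> V \<Longrightarrow> act (inv g) (act g x) = x"
  using act_mult[of g "inv g" x] act_mult[of "inv g" g x] by simp_all

lemma act_add: "g \<in> carrier G \<Longrightarrow> x \<in> V \<Longrightarrow> y \<in> V \<Longrightarrow> act g (x + y) = act g x + act g y"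
  using rho_carrier by (rule mult_add_distrib_mat_vec)

lemma act_minus: "g \<in> carrier G \<Longrightarrow> x \<in> V \<Longrightarrow> y \<in> V \<Longrightarrow> act g (x - y) = act g x - act g y"
  using rho_carrier by (rule mult_minus_distrib_mat_vec)

lemma act_smult: "g \<in> carrier G \<Longrightarrow> x \<in> V \<Longrightarrow> act g (a \<cdot>\<^sub>v x) = a \<cdot>\<^sub>v act g x"
  using rho_carrier by (rule mult_mat_vec)

lemma bil_act_left: "g \<in> carrier G \<Longrightarrow> x \<in> V \<Longrightarrow> y \<in> V \<Longrightarrow> bil (act g x) y = bil x (act (inv g) y)"
  using rho_isometry[of "inv g" "act g x" y] by simp

lemma act_sum: 
  assumes "g \<in> carrier G" "x \<in> V" "i < r"
  shows "act g x $ i = (\<Sum>j<r. \<rho> g $$ (i, j) * x $ j)"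
  by (rule mult_mat_vec_sum[OF rho_carrier[OF assms(1)] assms(2,3)])

lemma bil_sum:
  assumes "x \<in> V" "y \<in> V"
  shows "bil x y = (\<Sum>i<r. x $ i * (\<Sum>j<r. M $$ (i, j) * y $ j))"
proof -
  have d: "dim_vec (M *\<^sub>v y) = r"
    by (rule carrier_vecD[OF M_mult_carrier[OF assms(2)]])
  show ?thesis
    unfolding bil_def scalar_prod_def d atLeast0LessThan
    by (intro sum.cong refl arg_cong2[where f = "(*)"] mult_mat_vec_sum[OF M_carrier assms(2)]) simp
qed

text \<open>Discreteness of the action on hyperbolic space. If \<open>g\<close> moves \<open>y\<close> by a bounded amount, then
  \<open>g\<^sup>-\<^sup>1 y\<close> is bounded, hence so is the pairing of \<open>y\<close> with the image under \<open>g\<close> of any fixed vector.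
  Applied to the unit vectors, this bounds the columns of the integral matrix \<open>\<rho> g\<close>.\<close>

lemma finite_of_bounded_displacement:
  assumes y: "y \<in> V" "bil y y > 0" and S: "S \<subseteq> carrier G" and C: "\<And>g. g \<in> S \<Longrightarrow> \<bar>bil (act g y) y\<bar> \<le> C"
  shows "finite S"
proof -
  obtain R1 where R1: "\<And>w i. w \<in> V \<Longrightarrow> \<bar>bil w y\<bar> \<le> C \<Longrightarrow> \<bar>bil w w\<bar> \<le> bil y y \<Longrightarrow> i < r \<Longrightarrow> \<bar>w $ i\<bar> \<le> R1"
    using bounded_of_time_and_norm[OF y] by blast
  have inv_bound: "\<bar>act (inv g) y $ i\<bar> \<le> R1" if "g \<in> S" "i < r" for g i
  proof (rule R1)
    have g: "g \<in> carrier G" using that S by blast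
    then have "bil (act (inv g) y) y = bil (act g y) y"
      using bil_act_left[of "inv g" y y] bil_commute[of y "act g y"] y by simp
    then show "\<bar>bil (act (inv g) y) y\<bar> \<le> C" using C[OF that(1)] by simp
    show "\<bar>bil (act (inv g) y) (act (inv g) y)\<bar> \<le> bil y y"
      using rho_isometry[of "inv g" y y] g y by simp
    show "act (inv g) y \<in> V" using g y by simp
  qed (rule that(2))
  define A where "A j = (\<Sum>k<r. \<bar>M $$ (j, k)\<bar> * R1)" for j
  let ?u = "\<lambda>j. unit_vec r j :: real vec"
  have "\<exists>R. \<forall>g\<in>S. \<forall>i<r. \<bar>\<rho> g $$ (i, j)\<bar> \<le> R" if j: "j < r" for j
  proof -
    obtain R where R: "\<And>w i. w \<in> V \<Longrightarrow> \<bar>bil w y\<bar> \<le> A j \<Longrightarrow> \<bar>bil w w\<bar> \<le> \<bar>bil (?u j) (?u j)\<bar> \<Longrightarrow> i < r \<Longrightarrow> \<bar>w $ i\<bar> \<le> R"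
      using bounded_of_time_and_norm[OF y] by blast
    have "\<bar>\<rho> g $$ (i, j)\<bar> \<le> R" if "g \<in> S" "i < r" for g i
    proof -
      have g: "g \<in> carrier G" using that S by blast
      have "bil (act g (?u j)) y = bil (?u j) (act (inv g) y)"
        using bil_act_left[OF g] y by simp
      also have "\<dots> = (\<Sum>k<r. M $$ (j, k) * act (inv g) y $ k)"
      proof -
        have "bil (?u j) (act (inv g) y) = (M *\<^sub>v act (inv g) y) $ j"
          unfolding bil_def using j g y by (intro scalar_prod_left_unit) auto
        then show ?thesis using mult_mat_vec_sum[OF M_carrier _ j, of "act (inv g) y"] g y by simp
      qed
      finally have "\<bar>bil (act g (?u j)) y\<bar> \<le> (\<Sum>k<r. \<bar>M $$ (j, k)\<bar> * \<bar>act (inv g) y $ k\<bar>)"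
        by (metis (no_types, lifting) abs_mult sum.cong sum_abs)
      also have "\<dots> \<le> A j"
        unfolding A_def by (intro sum_mono mult_left_mono) (auto intro: inv_bound that)
      finally have "\<bar>act g (?u j) $ i\<bar> \<le> R"
        using R[of "act g (?u j)" i] g that rho_isometry[OF g, of "?u j" "?u j"] by simp
      then show ?thesis using rho_carrier[OF g] that j by simp
    qed
    then show ?thesis by blast
  qed
  then obtain R where R: "\<And>j g i. j < r \<Longrightarrow> g \<in> S \<Longrightarrow> i < r \<Longrightarrow> \<bar>\<rho> g $$ (i, j)\<bar> \<le> R j"
    by metis
  define R' where "R' = (\<Sum>j<r. \<bar>R j\<bar>)"
  have R': "\<bar>\<rho> g $$ (i, j)\<bar> \<le> R'" if "g \<in> S" "i < r" "j < r" for g i j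
  proof -
    have "\<bar>\<rho> g $$ (i, j)\<bar> \<le> \<bar>R j\<bar>" using R[OF that(3,1,2)] by linarith
    also have "\<dots> \<le> R'" unfolding R'_def using that by (intro member_le_sum) auto
    finally show ?thesis .
  qed
  have "\<rho> ` S \<subseteq> {A \<in> carrier_mat r r. \<forall>i<r. \<forall>j<r. A $$ (i, j) \<in> \<int> \<and> \<bar>A $$ (i, j)\<bar> \<le> R'}"
    using S R' rho_carrier rho_integral by blast
  then have "finite (\<rho> ` S)" using finite_bounded_integer_matrices finite_subset by blast
  then show ?thesis using finite_imageD inj_on_subset[OF rho_inj S] by blast
qed

lemma bil_tendsto:
  assumes "\<And>k. w k \<in> V" "\<And>k. z k \<in> V" "x \<in> V" "y \<in> V"
    and "\<And>i. i < r \<Longrightarrow> (\<lambda>k. w k $ i) \<longlonglongrightarrow> x $ i" "\<And>i. i < r \<Longrightarrow> (\<lambda>k. z k $ i) \<longlonglongrightarrow> y $ i"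
  shows "(\<lambda>k. bil (w k) (z k)) \<longlonglongrightarrow> bil x y"
proof -
  have eq: "bil (w k) (z k) = (\<Sum>i<r. w k $ i * (\<Sum>j<r. M $$ (i, j) * z k $ j))" for k
    using bil_sum assms(1,2) by blast
  show ?thesis
    unfolding eq bil_sum[OF assms(3,4)]
  proof (rule tendsto_sum)
    fix i assume "i \<in> {..<r}"
    then have i: "i < r" by simp
    have "(\<lambda>k. \<Sum>j<r. M $$ (i, j) * z k $ j) \<longlonglongrightarrow> (\<Sum>j<r. M $$ (i, j) * y $ j)"
      by (rule tendsto_sum, rule tendsto_mult_left, rule assms(6), simp)
    then show "(\<lambda>k. w k $ i * (\<Sum>j<r. M $$ (i, j) * z k $ j)) \<longlonglongrightarrow> x $ i * (\<Sum>j<r. M $$ (i, j) * y $ j)"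
      by (rule tendsto_mult[OF assms(5)[OF i]])
  qed
qed

text \<open>Infinitely many translates \<open>a y\<close> of a positive vector diverge by discreteness, although their
  norm is constant. Rescaled to have pairing \<open>1\<close> with \<open>y\<close>, they stay bounded, and a limit \<open>e\<close> is
  isotropic. If \<open>h\<close> moves all the \<open>a y\<close> by a bounded amount, then the rescaled pairings tend to \<open>0\<close>, so
  \<open>h e\<close> is orthogonal to \<open>e\<close> and hence on the same line. Geometrically, \<open>e\<close> is a point at infinity, and points
  at bounded distance have the same limit.\<close>

lemma isotropic_limit_line:
  assumes D: "infinite D" "D \<subseteq> carrier G" and y: "y \<in> V" "bil y y > 0"
  obtains e where "e \<in> V" "e \<noteq> 0\<^sub>v r" "bil e e = 0"
    "\<And>h C. h \<in> carrier G \<Longrightarrow> (\<And>a. a \<in> D \<Longrightarrow> \<bar>bil (act a y) (act h (act a y))\<bar> \<le> C) \<Longrightarrow> \<exists>\<mu>. act h e = \<mu> \<cdot>\<^sub>v e"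
proof -
  define t where "t a = bil (act a y) y" for a
  have fin: "finite {a \<in> D. \<bar>t a\<bar> \<le> C}" for C
    by (rule finite_of_bounded_displacement[OF y, of _ C]) (use D in \<open>auto simp: t_def\<close>)
  \<comment> \<open>Removing the finitely many elements with small \<open>t\<close> makes the rescaling well defined and keeps
    the norms of the rescaled vectors bounded.\<close>
  have "infinite (D - {a \<in> D. \<bar>t a\<bar> \<le> 1})" using D(1) fin by simp
  then obtain a :: "nat \<Rightarrow> 'g" where a: "inj a" "range a \<subseteq> D - {a \<in> D. \<bar>t a\<bar> \<le> 1}"
    using infinite_countable_subset by blast
  have "a k \<in> D - {a \<in> D. \<bar>t a\<bar> \<le> 1}" for k using a(2) by blast
  then have aD: "a k \<in> D" "a k \<in> carrier G" "\<bar>t (a k)\<bar> > 1" for k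
    using D(2) by (auto simp: not_le)
  have t_lim: "filterlim (\<lambda>k. \<bar>t (a k)\<bar>) at_top sequentially"
  proof (rule filterlim_at_top_gt[THEN iffD2, rule_format, of 0])
    fix C :: real
    have "finite (a -` {a \<in> D. \<bar>t a\<bar> \<le> C})" by (rule finite_vimageI[OF fin a(1)])
    then have "eventually (\<lambda>k. k \<notin> a -` {a \<in> D. \<bar>t a\<bar> \<le> C}) sequentially"
      unfolding cofinite_eq_sequentially[symmetric] by (simp add: eventually_cofinite)
    then show "eventually (\<lambda>k. C \<le> \<bar>t (a k)\<bar>) sequentially"
      by eventually_elim (use aD in auto)
  qed
  define w where "w k = (1 / t (a k)) \<cdot>\<^sub>v act (a k) y" for k
  have w: "w k \<in> V" for k using aD y by (simp add: w_def)
  have wy: "bil (w k) y = 1" for k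
    using aD[of k] y by (auto simp: w_def t_def)
  have ww: "bil (w k) (w k) = bil y y / (t (a k))\<^sup>2" for k
    using aD[of k] y rho_isometry[of "a k" y y] by (simp add: w_def power2_eq_square)
  have "(t (a k))\<^sup>2 \<ge> 1" for k
    using aD(3)[of k] by (metis less_imp_le one_le_power power2_abs)
  then have ww_le: "\<bar>bil (w k) (w k)\<bar> \<le> bil y y" for k
    unfolding ww using y(2) mult_left_mono[of 1 "(t (a k))\<^sup>2" "bil y y"]
    by (simp add: abs_divide divide_le_eq)
  obtain R where R: "\<And>k i. i < r \<Longrightarrow> \<bar>w k $ i\<bar> \<le> R"
    using bounded_of_time_and_norm[OF y, of 1 "bil y y"] w wy ww_le by (metis abs_one order_refl)
  obtain s l where s: "strict_mono s" "\<And>i. i < r \<Longrightarrow> (\<lambda>k. w (s k) $ i) \<longlonglongrightarrow> l i"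
    using coordinatewise_convergent_subsequence[of r "\<lambda>k i. w k $ i"] R by blast
  define e where "e = vec r l"
  have e: "e \<in> V" by (simp add: e_def)
  have lim: "(\<lambda>k. w (s k) $ i) \<longlonglongrightarrow> e $ i" if "i < r" for i
    using s(2)[OF that] that by (simp add: e_def)
  have t2: "(\<lambda>k. 1 / (t (a (s k)))\<^sup>2) \<longlonglongrightarrow> 0"
  proof -
    have "(\<lambda>k. inverse \<bar>t (a (s k))\<bar>) \<longlonglongrightarrow> 0"
      using tendsto_inverse_0_at_top[OF filterlim_compose[OF t_lim filterlim_subseq[OF s(1)]]] .
    from tendsto_mult[OF this this] show ?thesis
      by (simp add: power2_eq_square divide_inverse flip: abs_mult inverse_mult_distrib)
  qed
  have "(\<lambda>k. bil (w (s k)) y) \<longlonglongrightarrow> bil e y"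
    by (rule bil_tendsto) (use w y e lim in auto)
  then have "bil e y = 1" using wy LIMSEQ_unique[of "\<lambda>_. 1"] by auto
  then have e0: "e \<noteq> 0\<^sub>v r" using y by (auto simp: bil_def)
  have "(\<lambda>k. bil (w (s k)) (w (s k))) \<longlonglongrightarrow> bil e e"
    by (rule bil_tendsto) (use w y e lim in auto)
  moreover have "(\<lambda>k. bil (w (s k)) (w (s k))) \<longlonglongrightarrow> 0"
    using tendsto_mult_left[OF t2, of "bil y y"] by (simp add: ww)
  ultimately have ee: "bil e e = 0" by (rule LIMSEQ_unique)
  show ?thesis
  proof (rule that[OF e e0 ee])
    fix h C assume h: "h \<in> carrier G" and C: "\<And>a. a \<in> D \<Longrightarrow> \<bar>bil (act a y) (act h (act a y))\<bar> \<le> C"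
    have "(\<lambda>k. bil (w (s k)) (act h (w (s k)))) \<longlonglongrightarrow> bil e (act h e)"
    proof (rule bil_tendsto)
      show "(\<lambda>k. act h (w (s k)) $ i) \<longlonglongrightarrow> act h e $ i" if "i < r" for i
        unfolding act_sum[OF h w that] act_sum[OF h e that]
        by (intro tendsto_sum tendsto_mult tendsto_const lim) auto
    qed (use w h e lim in auto)
    moreover have "(\<lambda>k. bil (w (s k)) (act h (w (s k)))) \<longlonglongrightarrow> 0"
    proof (rule tendsto_0_le[OF t2])
      have "\<bar>bil (w k) (act h (w k))\<bar> \<le> C * (1 / (t (a k))\<^sup>2)" for k
      proof -
        have "bil (w k) (act h (w k)) = bil (act (a k) y) (act h (act (a k) y)) / (t (a k))\<^sup>2"
          using aD[of k] y h by (simp add: w_def act_smult power2_eq_square)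
        then show ?thesis
          using C[OF aD(1)[of k]] by (simp add: abs_divide divide_right_mono)
      qed
      then show "\<forall>\<^sub>F k in sequentially. norm (bil (w (s k)) (act h (w (s k)))) \<le> norm (1 / (t (a (s k)))\<^sup>2) * C"
        by (simp add: mult.commute)
    qed
    ultimately have "bil e (act h e) = 0" by (rule LIMSEQ_unique)
    then show "\<exists>\<mu>. act h e = \<mu> \<cdot>\<^sub>v e"
      using isotropic_orthogonal_proportional[OF e e0 ee, of "act h e"] rho_isometry[OF h e e] ee h e by auto
  qed
qed

end

section \<open>Finding a fixed isotropic line\<close>

context integral_lorentz_action
begin

lemma restrict_to_subgroup:
  assumes "subgroup H G"
  shows "integral_lorentz_action r M (G\<lparr>carrier := H\<rparr>) \<rho>"
proof -
  have H: "g \<in> carrier G" if "g \<in> H" for g using subgroup.mem_carrier[OF assms that] .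
  show ?thesis
    unfolding integral_lorentz_action_def integral_lorentz_action_axioms_def
    using subgroup_imp_group[OF assms] lorentz_form_axioms H rho_carrier rho_mult rho_one rho_integral M_integral
      rho_isometry inj_on_subset[OF rho_inj subgroup.subset[OF assms]]
    by simp
qed

text \<open>Three isotropic lines are too many: the multipliers \<open>\<mu>\<^sub>i\<close> satisfy \<open>\<mu>\<^sub>i \<mu>\<^sub>j = 1\<close> for \<open>i \<noteq> j\<close>,
  so all are equal to the same sign, and a positive vector in the span of two of the lines is fixed up to sign.\<close>

lemma finite_of_three_fixed_isotropic_lines:
  assumes D: "D \<subseteq> carrier G"
    and e: "e1 \<in> V" "e2 \<in> V" "e3 \<in> V" "bil e1 e1 = 0" "bil e2 e2 = 0"
    and distinct: "bil e1 e2 \<noteq> 0" "bil e1 e3 \<noteq> 0" "bil e2 e3 \<noteq> 0"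
    and fixed: "\<And>g. g \<in> D \<Longrightarrow> (\<exists>\<mu>. act g e1 = \<mu> \<cdot>\<^sub>v e1) \<and> (\<exists>\<mu>. act g e2 = \<mu> \<cdot>\<^sub>v e2) \<and> (\<exists>\<mu>. act g e3 = \<mu> \<cdot>\<^sub>v e3)"
  shows "finite D"
proof -
  define s where "s = sgn (bil e1 e2)"
  define y where "y = e1 + s \<cdot>\<^sub>v e2"
  have y: "y \<in> V" using e by (simp add: y_def)
  have yy: "bil y y = 2 * \<bar>bil e1 e2\<bar>"
    using e bil_commute[OF e(1,2)] by (simp add: y_def bil_linear s_def abs_sgn)
  show ?thesis
  proof (rule finite_of_bounded_displacement[OF y _ D])
    show "bil y y > 0" using yy distinct by simp
    fix g assume "g \<in> D"
    then have g: "g \<in> carrier G" using D by blast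
    obtain m1 m2 m3 where m: "act g e1 = m1 \<cdot>\<^sub>v e1" "act g e2 = m2 \<cdot>\<^sub>v e2" "act g e3 = m3 \<cdot>\<^sub>v e3"
      using fixed[OF \<open>g \<in> D\<close>] by blast
    have "m1 * m2 = 1" "m1 * m3 = 1" "m2 * m3 = 1"
      using rho_isometry[OF g e(1,2)] rho_isometry[OF g e(1,3)] rho_isometry[OF g e(2,3)] distinct e m
      by (simp_all add: mult.commute)
    then have m12: "m2 = m1" "\<bar>m1\<bar> = 1"
    proof -
      assume *: "m1 * m2 = 1" "m1 * m3 = 1" "m2 * m3 = 1"
      have "m1 \<noteq> 0" "m3 \<noteq> 0" using * by auto
      then have "m2 = m3" "m1 = m2" using * by (metis mult_left_cancel, metis mult_right_cancel)
      then have "m1 * m1 = 1" using * by simp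
      then show "m2 = m1" "\<bar>m1\<bar> = 1" using \<open>m1 = m2\<close> by (simp_all add: abs_square_eq_1 flip: power2_eq_square)
    qed
    have "act g y = act g e1 + s \<cdot>\<^sub>v act g e2"
      unfolding y_def using e(1,2) g by (simp add: act_add act_smult)
    also have "\<dots> = m1 \<cdot>\<^sub>v e1 + m1 \<cdot>\<^sub>v (s \<cdot>\<^sub>v e2)"
      unfolding m m12(1) by (simp only: smult_smult_assoc mult.commute)
    also have "\<dots> = m1 \<cdot>\<^sub>v y"
      unfolding y_def using e(1,2) by (intro smult_add_distrib_vec[of _ r, symmetric]) auto
    finally have "act g y = m1 \<cdot>\<^sub>v y" .
    then show "\<bar>bil (act g y) y\<bar> \<le> bil y y" using y yy m12(2) by (simp add: abs_mult)
  qed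
qed

lemma fixes_line_iff:
  assumes e: "e \<in> V" "e \<noteq> 0\<^sub>v r" "bil e e = 0" and g: "g \<in> carrier G"
  shows "(\<exists>\<mu>. act g e = \<mu> \<cdot>\<^sub>v e) \<longleftrightarrow> bil (act g e) e = 0"
proof
  assume "\<exists>\<mu>. act g e = \<mu> \<cdot>\<^sub>v e"
  then show "bil (act g e) e = 0" using e by auto
next
  assume "bil (act g e) e = 0"
  then have "bil e (act g e) = 0" using bil_commute e g by simp
  then show "\<exists>\<mu>. act g e = \<mu> \<cdot>\<^sub>v e"
    using isotropic_orthogonal_proportional[OF e, of "act g e"] rho_isometry[OF g e(1,1)] e g by auto
qed

lemma act_nonzero:
  assumes "g \<in> carrier G" "e \<in> V" "e \<noteq> 0\<^sub>v r"
  shows "act g e \<noteq> 0\<^sub>v r"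
proof
  assume "act g e = 0\<^sub>v r"
  then have "bil e y = 0" if "y \<in> V" for y
    using rho_isometry[OF assms(1,2) that] assms(1) that by (simp add: bil_def)
  then show False using bil_nondegenerate[OF _ assms(2)] assms(3) by blast
qed

lemma subgroup_fixing_line:
  assumes e: "e \<in> V" "e \<noteq> 0\<^sub>v r"
  shows "subgroup {g \<in> carrier G. \<exists>\<mu>. act g e = \<mu> \<cdot>\<^sub>v e} G"
proof (rule subgroupI)
  show "{g \<in> carrier G. \<exists>\<mu>. act g e = \<mu> \<cdot>\<^sub>v e} \<noteq> {}"
    using e(1) act_one[OF e(1)] one_closed by (metis (mono_tags, lifting) empty_iff mem_Collect_eq one_smult_vec)
next
  fix g assume "g \<in> {g \<in> carrier G. \<exists>\<mu>. act g e = \<mu> \<cdot>\<^sub>v e}"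
  then obtain m where g: "g \<in> carrier G" "act g e = m \<cdot>\<^sub>v e" by blast
  have m: "m \<noteq> 0"
  proof
    assume "m = 0"
    then have "act g e = 0\<^sub>v r" using g(2) e by auto
    then show False using act_nonzero[OF g(1) e] by simp
  qed
  have "e = m \<cdot>\<^sub>v act (inv g) e"
    using act_inv(2)[OF g(1) e(1)] act_smult[of "inv g" e m] g e by simp
  then have "(1 / m) \<cdot>\<^sub>v e = (1 / m) \<cdot>\<^sub>v (m \<cdot>\<^sub>v act (inv g) e)" by simp
  then have "act (inv g) e = (1 / m) \<cdot>\<^sub>v e" using m by (simp add: smult_smult_assoc)
  then show "inv g \<in> {g \<in> carrier G. \<exists>\<mu>. act g e = \<mu> \<cdot>\<^sub>v e}" using g by blast
next
  fix g h assume "g \<in> {g \<in> carrier G. \<exists>\<mu>. act g e = \<mu> \<cdot>\<^sub>v e}" "h \<in> {g \<in> carrier G. \<exists>\<mu>. act g e = \<mu> \<cdot>\<^sub>v e}"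
  then obtain m n where g: "g \<in> carrier G" "act g e = m \<cdot>\<^sub>v e" and h: "h \<in> carrier G" "act h e = n \<cdot>\<^sub>v e" by blast
  have "act (g \<otimes> h) e = (n * m) \<cdot>\<^sub>v e"
    using g h e by (simp add: act_mult act_smult smult_smult_assoc)
  then show "g \<otimes> h \<in> {g \<in> carrier G. \<exists>\<mu>. act g e = \<mu> \<cdot>\<^sub>v e}" using g h by blast
qed auto

text \<open>The elements of \<open>D\<close> commute up to the finite set \<open>F\<close>, so \<open>h \<in> D\<close> moves \<open>a y\<close> by the same amount as
  some \<open>h c\<close> with \<open>c \<in> F\<close> moves \<open>y\<close>. This is bounded independently of \<open>a \<in> D\<close>, so \<open>D\<close> fixes a limit line \<open>e\<close> of
  its own orbit. As \<open>D\<close> is normal, it also fixes all translates of this line by the ambient group, and as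
  \<open>D\<close> is infinite, there are at most two of them.\<close>

theorem infinite_normal_almost_commutative_subgroup_fixes_line:
  assumes D: "infinite D" "D \<subseteq> carrier G"
    and normal: "\<And>g d. g \<in> carrier G \<Longrightarrow> d \<in> D \<Longrightarrow> g \<otimes> d \<otimes> inv g \<in> D"
    and F: "finite F" "F \<subseteq> carrier G" "\<And>a h. a \<in> D \<Longrightarrow> h \<in> D \<Longrightarrow> inv h \<otimes> inv a \<otimes> h \<otimes> a \<in> F"
  obtains e where "e \<in> V" "e \<noteq> 0\<^sub>v r" "bil e e = 0" "finite_index G {g \<in> carrier G. \<exists>\<mu>. act g e = \<mu> \<cdot>\<^sub>v e}"
proof -
  obtain y where y: "y \<in> V" "bil y y > 0" by (rule positive_vector_exists)
  obtain e where e: "e \<in> V" "e \<noteq> 0\<^sub>v r" "bil e e = 0"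
    and lim: "\<And>h C. h \<in> carrier G \<Longrightarrow> (\<And>a. a \<in> D \<Longrightarrow> \<bar>bil (act a y) (act h (act a y))\<bar> \<le> C) \<Longrightarrow> \<exists>\<mu>. act h e = \<mu> \<cdot>\<^sub>v e"
    using isotropic_limit_line[OF D y] by blast
  have fixed: "\<exists>\<mu>. act h e = \<mu> \<cdot>\<^sub>v e" if h: "h \<in> D" for h
  proof (rule lim)
    show hG: "h \<in> carrier G" using h D by blast
    fix a assume a: "a \<in> D"
    then have aG: "a \<in> carrier G" using D by blast
    define c where "c = inv h \<otimes> inv a \<otimes> h \<otimes> a"
    have c: "c \<in> F" using F(3)[OF a h] by (simp add: c_def)
    have "h \<otimes> a = a \<otimes> (h \<otimes> c)"
      unfolding c_def using hG aG by (simp add: m_assoc inv_solve_left flip: m_assoc)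
    then have "act h (act a y) = act a (act h (act c y))"
      using hG aG y c F by (metis act_carrier act_mult m_closed subsetD)
    then have "bil (act a y) (act h (act a y)) = bil y (act h (act c y))"
      using rho_isometry[OF aG y(1), of "act h (act c y)"] hG c F y by auto
    also have "\<bar>\<dots>\<bar> \<le> (\<Sum>c\<in>F. \<bar>bil y (act h (act c y))\<bar>)"
      using member_le_sum[OF c, of "\<lambda>c. \<bar>bil y (act h (act c y))\<bar>"] F by simp
    finally show "\<bar>bil (act a y) (act h (act a y))\<bar> \<le> (\<Sum>c\<in>F. \<bar>bil y (act h (act c y))\<bar>)" .
  qed
  have fixed_conj: "\<exists>\<mu>. act d (act (inv g) e) = \<mu> \<cdot>\<^sub>v act (inv g) e" if g: "g \<in> carrier G" and d: "d \<in> D" for g d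
  proof -
    have dG: "d \<in> carrier G" using d D by blast
    obtain \<mu> where "act (g \<otimes> d \<otimes> inv g) e = \<mu> \<cdot>\<^sub>v e" using fixed[OF normal[OF g d]] by blast
    then have "act g (act d (act (inv g) e)) = \<mu> \<cdot>\<^sub>v e" using g dG e by (simp add: act_mult)
    then have "act (inv g) (act g (act d (act (inv g) e))) = \<mu> \<cdot>\<^sub>v act (inv g) e"
      using g e by (simp add: act_smult)
    then show ?thesis using g dG e by auto
  qed
  let ?S = "{g \<in> carrier G. \<exists>\<mu>. act g e = \<mu> \<cdot>\<^sub>v e}"
  have S: "subgroup ?S G" by (rule subgroup_fixing_line[OF e(1,2)])
  \<comment> \<open>The lines \<open>g\<^sup>-\<^sup>1 e\<close> different from \<open>e\<close> all coincide, so one bit determines the coset.\<close>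
  have "finite_index G ?S"
  proof (rule finite_index_of_invariant[OF S, where \<tau> = "\<lambda>g. bil (act (inv g) e) e = 0"])
    show "finite ((\<lambda>g. bil (act (inv g) e) e = 0) ` carrier G)"
      by (rule finite_subset[OF subset_UNIV]) simp
    fix g h assume g: "g \<in> carrier G" and h: "h \<in> carrier G"
      and eq: "(bil (act (inv g) e) e = 0) = (bil (act (inv h) e) e = 0)"
    show "g \<otimes> inv h \<in> ?S"
    proof (cases "bil (act (inv g) e) e = 0")
      case True
      then have "inv g \<in> ?S" "inv h \<in> ?S"
        using eq fixes_line_iff[OF e] g h by auto
      then show ?thesis using subgroup.m_inv_closed[OF S, of "inv g"] subgroup.m_closed[OF S] g by simp
    next
      case False
      define e2 where "e2 = act (inv g) e"
      define e3 where "e3 = act (inv h) e"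
      have e23: "e2 \<in> V" "e3 \<in> V" "bil e2 e2 = 0" "bil e3 e3 = 0"
        using g h e rho_isometry[of "inv g" e e] rho_isometry[of "inv h" e e] by (simp_all add: e2_def e3_def)
      have ne: "bil e e2 \<noteq> 0" "bil e e3 \<noteq> 0"
        using False eq bil_commute[OF e(1) e23(1)] bil_commute[OF e(1) e23(2)] by (auto simp: e2_def e3_def)
      have "bil e2 e3 = 0"
      proof (rule ccontr)
        assume "bil e2 e3 \<noteq> 0"
        then have "finite D"
          using finite_of_three_fixed_isotropic_lines[OF D(2) e(1) e23(1,2) e(3) e23(3) ne] fixed
            fixed_conj[OF g] fixed_conj[OF h] by (auto simp: e2_def e3_def)
        then show False using D by simp
      qed
      then have "bil e (act g (act (inv h) e)) = 0"
        using bil_act_left[of "inv g" e e3] g e e23 by (simp add: e2_def e3_def)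
      then have "bil (act (g \<otimes> inv h) e) e = 0"
        using bil_commute[of e "act g (act (inv h) e)"] g h e by (simp add: act_mult)
      then show ?thesis using fixes_line_iff[OF e, of "g \<otimes> inv h"] g h by simp
    qed
  qed
  then show ?thesis using that e by blast
qed

end

section \<open>Groups that fix an isotropic line\<close>

locale line_fixing_action = integral_lorentz_action +
  fixes e :: "real vec"
  assumes e_carrier [simp]: "e \<in> carrier_vec r" and e_nonzero: "e \<noteq> 0\<^sub>v r" and e_isotropic: "bil e e = 0"
    and fixes_e: "g \<in> carrier G \<Longrightarrow> \<exists>\<mu>. \<rho> g *\<^sub>v e = \<mu> \<cdot>\<^sub>v e"
begin

definition multiplier :: "'a \<Rightarrow> real" where
  "multiplier g = (SOME \<mu>. act g e = \<mu> \<cdot>\<^sub>v e)"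

lemma act_e: "g \<in> carrier G \<Longrightarrow> act g e = multiplier g \<cdot>\<^sub>v e"
  unfolding multiplier_def by (rule someI_ex[OF fixes_e])

lemma smult_e_eq [simp]: "a \<cdot>\<^sub>v e = b \<cdot>\<^sub>v e \<longleftrightarrow> a = b"
proof
  assume eq: "a \<cdot>\<^sub>v e = b \<cdot>\<^sub>v e"
  obtain i where i: "i < r" "e $ i \<noteq> 0"
    using e_nonzero e_carrier by (metis carrier_vecD eq_vecI index_zero_vec)
  then have "a * e $ i = b * e $ i" using arg_cong[OF eq, of "\<lambda>v. v $ i"] e_carrier by simp
  then show "a = b" using i by simp
qed simp

lemma multiplier_mult:
  assumes g: "g \<in> carrier G" and h: "h \<in> carrier G"
  shows "multiplier (g \<otimes> h) = multiplier g * multiplier h"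
proof -
  have "multiplier (g \<otimes> h) \<cdot>\<^sub>v e = act g (act h e)"
    using act_e[of "g \<otimes> h"] act_mult[OF g h e_carrier] g h by simp
  also have "\<dots> = multiplier h \<cdot>\<^sub>v (multiplier g \<cdot>\<^sub>v e)"
    unfolding act_e[OF h] act_smult[OF g e_carrier] act_e[OF g] ..
  also have "\<dots> = (multiplier g * multiplier h) \<cdot>\<^sub>v e"
    by (simp only: smult_smult_assoc mult.commute)
  finally show ?thesis by simp
qed

lemma multiplier_one: "multiplier \<one> = 1"
  using act_e[of \<one>] smult_e_eq[of "multiplier \<one>" 1] by simp

lemma multiplier_inv: "g \<in> carrier G \<Longrightarrow> multiplier g * multiplier (inv g) = 1"
  using multiplier_mult[of g "inv g"] multiplier_one by simp

lemma multiplier_nonzero: "g \<in> carrier G \<Longrightarrow> multiplier g \<noteq> 0"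
  using multiplier_inv by force

lemma multiplier_pow: "g \<in> carrier G \<Longrightarrow> multiplier (g [^] (n :: nat)) = multiplier g ^ n"
  by (induction n) (simp_all add: multiplier_one multiplier_mult)

text \<open>The form conjugates the transpose of an isometry to its inverse. So \<open>M e\<close> is an eigenvector of the
  transpose for the inverse multiplier, which is then also an eigenvalue of the isometry itself.\<close>

lemma opposite_eigenvector:
  assumes h: "h \<in> carrier G"
  obtains f where "f \<in> V" "f \<noteq> 0\<^sub>v r" "act h f = (1 / multiplier h) \<cdot>\<^sub>v f"
proof -
  define k where "k = 1 / multiplier h"
  have k: "multiplier (inv h) = k"
    using multiplier_inv[OF h] multiplier_nonzero[OF h] by (simp add: k_def field_simps)
  define T where "T = transpose_mat (\<rho> h)"
  have T: "T \<in> carrier_mat r r" using rho_carrier[OF h] by (simp add: T_def)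
  have eig: "T *\<^sub>v (M *\<^sub>v e) = k \<cdot>\<^sub>v (M *\<^sub>v e)"
  proof (rule eq_vecI)
    fix i assume "i < dim_vec (k \<cdot>\<^sub>v (M *\<^sub>v e))"
    then have i: "i < r" using M_carrier by simp
    have "(T *\<^sub>v (M *\<^sub>v e)) $ i = (T *\<^sub>v (M *\<^sub>v e)) \<bullet> unit_vec r i"
      using T i by (simp add: scalar_prod_right_unit mult_mat_vec_carrier[OF T])
    also have "\<dots> = (M *\<^sub>v e) \<bullet> act h (unit_vec r i)"
      unfolding T_def by (rule transpose_vec_mult_scalar[OF rho_carrier[OF h]]) simp_all
    also have "\<dots> = bil (act h (unit_vec r i)) e"
      unfolding bil_def using h by (intro comm_scalar_prod[of _ r]) auto
    also have "\<dots> = k * bil (unit_vec r i) e"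
      using h bil_act_left[OF h, of "unit_vec r i" e] act_e[of "inv h"] k by simp
    also have "\<dots> = (k \<cdot>\<^sub>v (M *\<^sub>v e)) $ i"
    proof -
      have "bil (unit_vec r i) e = (M *\<^sub>v e) $ i"
        unfolding bil_def using i by (intro scalar_prod_left_unit) simp
      then show ?thesis using i carrier_vecD[OF M_mult_carrier[OF e_carrier]] by (simp del: index_mult_mat_vec)
    qed
    finally show "(T *\<^sub>v (M *\<^sub>v e)) $ i = (k \<cdot>\<^sub>v (M *\<^sub>v e)) $ i" .
  qed (use T carrier_matD[OF M_carrier] in auto)
  have "M *\<^sub>v e \<noteq> 0\<^sub>v r"
  proof
    assume "M *\<^sub>v e = 0\<^sub>v r"
    then have "bil e y = 0" if "y \<in> V" for y
      using bil_commute[OF e_carrier that] that by (simp add: bil_def)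
    then show False using bil_nondegenerate[of e] e_nonzero by simp
  qed
  then have "eigenvalue T k"
    unfolding eigenvalue_def eigenvector_def using eig T by (intro exI[of _ "M *\<^sub>v e"]) auto
  then have "poly (char_poly (\<rho> h)) k = 0"
    using eigenvalue_root_char_poly[OF T] char_poly_transpose_mat[OF rho_carrier[OF h]] by (simp add: T_def)
  then have "eigenvalue (\<rho> h) k"
    using eigenvalue_root_char_poly[OF rho_carrier[OF h]] by simp
  then show ?thesis
    using that rho_carrier[OF h] unfolding eigenvalue_def eigenvector_def k_def by auto
qed

text \<open>If some multiplier does not have absolute value \<open>1\<close>, then the whole group fixes a second isotropic
  line. Take \<open>h\<close> with multiplier \<open>m\<close> of absolute value greater than \<open>1\<close>, and let \<open>f\<close> be its
  opposite eigenvector. For \<open>g\<close> in the group, the conjugates \<open>h\<^sup>-\<^sup>n g h\<^sup>n\<close> move \<open>e + f\<close> by a bounded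
  amount, because \<open>g\<close> keeps the expanded line \<open>e\<close>. So two of them are equal, while the pairing of \<open>f\<close>
  with its image under them is \<open>m\<^sup>-\<^sup>2\<^sup>n\<close> times the pairing of \<open>f\<close> with \<open>g f\<close>; hence the latter is \<open>0\<close>.\<close>

lemma fixes_opposite_line:
  assumes h0: "h0 \<in> carrier G" "\<bar>multiplier h0\<bar> \<noteq> 1"
  obtains f where "f \<in> V" "bil f f = 0" "bil e f = 1" "\<And>g. g \<in> carrier G \<Longrightarrow> act g f = (1 / multiplier g) \<cdot>\<^sub>v f"
proof -
  obtain h where h: "h \<in> carrier G" "\<bar>multiplier h\<bar> > 1"
  proof (cases "\<bar>multiplier h0\<bar> > 1")
    case False
    have "\<bar>multiplier h0\<bar> * \<bar>multiplier (inv h0)\<bar> = 1"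
      using multiplier_inv[OF h0(1)] by (metis abs_mult abs_one)
    moreover have "\<bar>multiplier h0\<bar> < 1" "\<bar>multiplier h0\<bar> > 0" using False h0 multiplier_nonzero[OF h0(1)] by auto
    ultimately have "\<bar>multiplier (inv h0)\<bar> > 1"
      by (metis abs_ge_zero less_le_not_le linorder_not_le mult_left_le_one_le mult.commute mult_le_one less_eq_real_def)
    then show ?thesis using that h0 by blast
  qed (use h0 that in blast)
  define m where "m = multiplier h"
  have m0: "m \<noteq> 0" using h by (auto simp: m_def)
  obtain f0 where f0: "f0 \<in> V" "f0 \<noteq> 0\<^sub>v r" "act h f0 = (1 / m) \<cdot>\<^sub>v f0"
    using opposite_eigenvector[OF h(1)] by (auto simp: m_def)
  have m2: "m * m \<noteq> 1" using h(2) by (metis abs_mult abs_one less_irrefl m_def mult_strict_mono' abs_ge_zero mult.left_neutral zero_le_one)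
  have iso: "bil f0 f0 = 0"
    using rho_isometry[OF h(1) f0(1,1)] f0 m0 m2 by (simp add: field_simps)
  have ne: "bil e f0 \<noteq> 0"
  proof
    assume "bil e f0 = 0"
    then obtain a where a: "f0 = a \<cdot>\<^sub>v e"
      using isotropic_orthogonal_proportional[OF e_carrier e_nonzero e_isotropic f0(1) iso] by blast
    then have "(a * m) \<cdot>\<^sub>v e = (1 / m * a) \<cdot>\<^sub>v e"
      using f0(3) act_e[OF h(1)] h(1) by (simp add: act_smult smult_smult_assoc m_def)
    then have "a * m = 1 / m * a" by simp
    then have "a = 0" using m0 m2 by (simp add: field_simps)
    then have "f0 = 0\<^sub>v r" using a carrier_vecD[OF e_carrier] by (intro eq_vecI) (auto simp del: e_carrier)
    then show False using f0 by simp
  qed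
  define f where "f = (1 / bil e f0) \<cdot>\<^sub>v f0"
  have f: "f \<in> V" "bil f f = 0" "bil e f = 1" "act h f = (1 / m) \<cdot>\<^sub>v f"
    using f0 iso ne h(1) by (simp_all add: f_def act_smult smult_smult_assoc mult.commute)
  have f_ne: "f \<noteq> 0\<^sub>v r"
  proof
    assume "f = 0\<^sub>v r"
    then have "bil f e = 0" by (simp add: bil_def)
    then show False using bil_commute[OF e_carrier f(1)] f(3) by simp
  qed
  have pow_e: "act (h [^] n) e = m ^ n \<cdot>\<^sub>v e" for n :: nat
    using act_e[of "h [^] n"] h multiplier_pow[of h n] by (simp add: m_def)
  have pow_f: "act (h [^] n) f = (1 / m) ^ n \<cdot>\<^sub>v f" for n :: nat
    by (induction n) (use f h in \<open>simp_all add: act_mult act_smult smult_smult_assoc\<close>)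
  define y where "y = e + f"
  have y: "y \<in> V" "bil y y = 2"
    using f e_isotropic bil_commute[OF e_carrier f(1)] by (simp_all add: y_def bil_linear)
  have orth: "bil (act g f) f = 0" if g: "g \<in> carrier G" for g
  proof -
    define gn where "gn n = inv (h [^] n) \<otimes> g \<otimes> h [^] n" for n :: nat
    have gn: "gn n \<in> carrier G" for n using g h by (simp add: gn_def)
    have conj: "bil (act (gn n) x) x = bil (act g (act (h [^] n) x)) (act (h [^] n) x)" if "x \<in> V" for n x
      using that g h bil_act_left[of "inv (h [^] n)" "act g (act (h [^] n) x)" x] by (simp add: gn_def act_mult)
    define C where "C = \<bar>bil (act g e) f\<bar> + \<bar>bil (act g f) e\<bar> + \<bar>bil (act g f) f\<bar>"
    have "\<bar>bil (act (gn n) y) y\<bar> \<le> C" for n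
    proof -
      have pm: "m ^ n * (1 / m) ^ n = 1" using m0 by (simp add: power_one_over)
      have "bil (act (gn n) y) y = (m ^ n * (1 / m) ^ n) * bil (act g e) f + (m ^ n * (1 / m) ^ n) * bil (act g f) e
          + ((1 / m) ^ n * (1 / m) ^ n) * bil (act g f) f"
        unfolding conj[OF y(1)] using g h f act_e[OF g] e_isotropic
        by (simp add: y_def act_add act_smult bil_linear pow_e pow_f algebra_simps del: power_one_over)
      then have "bil (act (gn n) y) y = bil (act g e) f + bil (act g f) e + ((1 / m) ^ n * (1 / m) ^ n) * bil (act g f) f"
        unfolding pm by simp
      moreover have "\<bar>((1 / m) ^ n * (1 / m) ^ n) * bil (act g f) f\<bar> \<le> 1 * \<bar>bil (act g f) f\<bar>"
      proof -
        have "\<bar>1 / m\<bar> \<le> 1" using h(2) by (simp add: m_def)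
        then have "\<bar>1 / m\<bar> ^ n \<le> 1" by (simp add: power_le_one)
        then have "\<bar>(1 / m) ^ n\<bar> * \<bar>(1 / m) ^ n\<bar> \<le> 1" by (metis abs_ge_zero mult_le_one power_abs)
        then show ?thesis unfolding abs_mult by (intro mult_right_mono) auto
      qed
      ultimately show ?thesis unfolding C_def by linarith
    qed
    then have "finite (range gn)"
      using gn y by (intro finite_of_bounded_displacement[of y _ C]) auto
    then have "\<not> inj gn" using finite_imageD infinite_UNIV_nat by blast
    then obtain i j where ij: "gn i = gn j" "i < j" by (metis injI linorder_neqE_nat)
    have val: "bil (act (gn n) f) f = (1 / m) ^ (2 * n) * bil (act g f) f" for n
      unfolding conj[OF f(1)] using g h f by (simp add: pow_f act_smult mult_2 power_add del: power_one_over)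
    have "(1 / m) ^ (2 * i) \<noteq> (1 / m) ^ (2 * j)"
    proof -
      have "\<bar>1 / m\<bar> ^ (2 * j) < \<bar>1 / m\<bar> ^ (2 * i)"
        using h(2) m0 ij(2) by (intro power_strict_decreasing) (auto simp: m_def)
      then show ?thesis by (metis less_irrefl power_abs)
    qed
    then show ?thesis using val[of i] val[of j] ij(1) by simp
  qed
  have "act g f = (1 / multiplier g) \<cdot>\<^sub>v f" if g: "g \<in> carrier G" for g
  proof -
    obtain a where a: "act g f = a \<cdot>\<^sub>v f"
      using fixes_line_iff[OF f(1) f_ne f(2) g] orth[OF g] by blast
    have "multiplier g * a = 1"
      using rho_isometry[OF g e_carrier f(1)] act_e[OF g] a f by (simp add: mult.commute)
    then have "a = 1 / multiplier g" using multiplier_nonzero[OF g] by (simp add: field_simps)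
    then show ?thesis using a by simp
  qed
  then show ?thesis using that f by blast
qed

text \<open>On the plane spanned by \<open>e\<close> and the second fixed line, a group element acts by its multiplier and the
  inverse of its multiplier, so the multiplier controls the displacement of a positive vector. By discreteness, the logarithm of the multiplier has discrete image and finite kernel.\<close>

lemma virtually_finite_by_lattice_of_loxodromic:
  assumes h0: "h0 \<in> carrier G" "\<bar>multiplier h0\<bar> \<noteq> 1"
  shows "virtually_finite_by_lattice G"
proof -
  obtain f where f: "f \<in> V" "bil f f = 0" "bil e f = 1" "\<And>g. g \<in> carrier G \<Longrightarrow> act g f = (1 / multiplier g) \<cdot>\<^sub>v f"
    using fixes_opposite_line[OF h0] by blast
  define y where "y = e + f"
  have y: "y \<in> V" "bil y y = 2"
    using f e_isotropic bil_commute[OF e_carrier f(1)] by (simp_all add: y_def bil_linear)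
  have disp: "bil (act g y) y = multiplier g + 1 / multiplier g" if g: "g \<in> carrier G" for g
    using f e_isotropic bil_commute[OF e_carrier f(1)] act_e[OF g] g
    by (simp add: y_def act_add bil_linear)
  define \<psi> where "\<psi> g = ln \<bar>multiplier g\<bar>" for g
  have add: "\<psi> (g \<otimes> h) = \<psi> g + \<psi> h" if "g \<in> carrier G" "h \<in> carrier G" for g h
    using that multiplier_nonzero by (simp add: \<psi>_def multiplier_mult abs_mult ln_mult)
  have fin: "finite {g \<in> carrier G. \<bar>\<psi> g\<bar> \<le> K}" for K
  proof (rule finite_of_bounded_displacement[of y _ "2 * exp K"])
    fix g assume "g \<in> {g \<in> carrier G. \<bar>\<psi> g\<bar> \<le> K}"
    then have g: "g \<in> carrier G" and K: "\<psi> g \<le> K" "- \<psi> g \<le> K" by auto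
    have m: "\<bar>multiplier g\<bar> = exp (\<psi> g)" using multiplier_nonzero[OF g] by (simp add: \<psi>_def)
    then have "\<bar>1 / multiplier g\<bar> = exp (- \<psi> g)" by (simp add: exp_minus inverse_eq_divide)
    moreover have "exp (\<psi> g) \<le> exp K" "exp (- \<psi> g) \<le> exp K" using K by simp_all
    ultimately show "\<bar>bil (act g y) y\<bar> \<le> 2 * exp K" unfolding disp[OF g] using m by linarith
  qed (use y in auto)
  obtain \<psi>' :: "_ \<Rightarrow> int" and c :: real where c: "0 < c" "\<And>g. g \<in> carrier G \<Longrightarrow> \<psi> g = c * \<psi>' g"
    using discrete_real_homomorphism[of \<psi>, OF add fin] by blast
  have "\<psi>' (g \<otimes> h) = \<psi>' g + \<psi>' h" if "g \<in> carrier G" "h \<in> carrier G" for g h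
  proof -
    have "c * real_of_int (\<psi>' (g \<otimes> h)) = c * real_of_int (\<psi>' g + \<psi>' h)"
      using add[OF that] c(2) that by (simp add: distrib_left)
    then show ?thesis using c(1) by (metis mult_left_cancel of_int_eq_iff less_irrefl)
  qed
  moreover have "{g \<in> carrier G. \<psi>' g = 0} \<subseteq> {g \<in> carrier G. \<bar>\<psi> g\<bar> \<le> 0}" using c by auto
  then have "finite {g \<in> carrier G. \<psi>' g = 0}" using fin finite_subset by blast
  moreover note finite_index_carrier
  ultimately show ?thesis
    unfolding virtually_finite_by_lattice_def
    by (intro exI[of _ "carrier G"] exI[of _ "1"] exI[of _ "\<lambda>g _. \<psi>' g"]) (auto simp: subgroup_self)
qed

end

text \<open>Coordinate functions of the real numbers as a vector space over the rational numbers. They turn a real vector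
  fixed by integral matrices into a rational one.\<close>

lemma rational_functional:
  fixes x :: real
  assumes "x \<noteq> 0"
  obtains \<phi> :: "real \<Rightarrow> real" where "\<And>a b. \<phi> (a + b) = \<phi> a + \<phi> b" "\<And>q a. q \<in> \<rat> \<Longrightarrow> \<phi> (q * a) = q * \<phi> a"
    "\<And>a. \<phi> a \<in> \<rat>" "\<phi> x \<noteq> 0"
proof -
  interpret vector_space_pair "\<lambda>(q :: rat) (a :: real). of_rat q * a" "(*) :: rat \<Rightarrow> rat \<Rightarrow> rat"
    by unfold_locales (auto simp: algebra_simps of_rat_add of_rat_mult)
  have "vs1.independent {x}" using assms by (simp add: vs1.dependent_single)
  from linear_independent_extend[OF this, of "\<lambda>_. 1"]
  obtain f where f: "Vector_Spaces.linear (\<lambda>q a. of_rat q * a) (*) f" "f x = 1" by auto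
  interpret f: Vector_Spaces.linear "\<lambda>(q :: rat) (a :: real). of_rat q * a" "(*) :: rat \<Rightarrow> rat \<Rightarrow> rat" f by (rule f(1))
  show ?thesis
  proof (rule that[of "\<lambda>a. of_rat (f a)"])
    show "of_rat (f (a + b)) = of_rat (f a) + (of_rat (f b) :: real)" for a b
      by (simp add: f.add of_rat_add)
    show "of_rat (f (q * a)) = q * (of_rat (f a) :: real)" if q: "q \<in> \<rat>" for q a
    proof -
      obtain q' where "q = of_rat q'" using q by (rule Rats_cases)
      then show ?thesis by (simp add: f.scale of_rat_mult)
    qed
  qed (simp_all add: f)
qed

lemma common_denominator:
  fixes q :: "nat \<Rightarrow> real"
  assumes "\<And>i. i < n \<Longrightarrow> q i \<in> \<rat>"
  obtains d :: nat where "0 < d" "\<And>i. i < n \<Longrightarrow> real d * q i \<in> \<int>"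
proof -
  have "\<exists>d :: nat. 0 < d \<and> real d * q i \<in> \<int>" if i: "i < n" for i
  proof -
    obtain a b :: int where ab: "b > 0" "q i = of_int a / of_int b"
      by (rule Rats_cases'[OF assms[OF i]])
    then have "real (nat b) * q i = of_int a" by simp
    then show ?thesis using ab(1) by (intro exI[of _ "nat b"]) simp
  qed
  then obtain d :: "nat \<Rightarrow> nat" where d: "\<And>i. i < n \<Longrightarrow> 0 < d i \<and> real (d i) * q i \<in> \<int>" by metis
  show ?thesis
  proof (rule that[of "\<Prod>i<n. d i"])
    show "0 < (\<Prod>i<n. d i)" using d by (intro prod_pos) auto
    fix i assume i: "i < n"
    have "(\<Prod>i<n. d i) = d i * (\<Prod>j\<in>{..<n} - {i}. d j)" using i by (intro prod.remove) auto
    then have "real (\<Prod>i<n. d i) * q i = (real (d i) * q i) * real (\<Prod>j\<in>{..<n} - {i}. d j)" by simp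
    also have "\<dots> \<in> \<int>" by (rule Ints_mult[OF conjunct2[OF d[OF i]] Ints_of_nat])
    finally show "real (\<Prod>i<n. d i) * q i \<in> \<int>" .
  qed
qed

lemma additive_sum:
  fixes f :: "'a :: ab_group_add \<Rightarrow> 'b :: ab_group_add"
  assumes "\<And>a b. f (a + b) = f a + f b"
  shows "f (sum g S) = (\<Sum>x\<in>S. f (g x))"
proof (induction S rule: infinite_finite_induct)
  case (insert x S)
  then show ?case by (simp add: assms)
qed (use assms[of 0 0] in simp_all)

context line_fixing_action
begin

text \<open>If infinitely many group elements fix \<open>e\<close> itself, then the line of \<open>e\<close> is rational. Apply a functional \<open>\<phi>\<close>
  that is linear over the rational numbers to the entries of \<open>e\<close>. The resulting rational vector \<open>v\<close> is fixed by the same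
  elements. They form an infinite set, so none of their common fixed vectors is positive, which
  forces \<open>v\<close> to be orthogonal to \<open>e\<close>. Applying \<open>\<phi>\<close> to this relation, whose coefficients are
  rational, shows that \<open>v\<close> is orthogonal to itself, so \<open>v\<close> is a multiple of \<open>e\<close>.\<close>

lemma integral_fixed_vector:
  assumes inf: "infinite {g \<in> carrier G. multiplier g = 1}"
  obtains w where "w \<in> V" "w \<noteq> 0\<^sub>v r" "bil w w = 0" "\<And>i. i < r \<Longrightarrow> w $ i \<in> \<int>"
    "\<And>g. g \<in> carrier G \<Longrightarrow> act g w = multiplier g \<cdot>\<^sub>v w"
proof -
  define U where "U = {g \<in> carrier G. multiplier g = 1}"
  obtain i0 where i0: "i0 < r" "e $ i0 \<noteq> 0"
    using e_nonzero e_carrier by (metis carrier_vecD eq_vecI index_zero_vec)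
  obtain \<phi> :: "real \<Rightarrow> real" where \<phi>: "\<And>a b. \<phi> (a + b) = \<phi> a + \<phi> b" "\<And>q a. q \<in> \<rat> \<Longrightarrow> \<phi> (q * a) = q * \<phi> a"
    "\<And>a. \<phi> a \<in> \<rat>" "\<phi> (e $ i0) \<noteq> 0"
    using rational_functional[OF i0(2)] by metis
  note \<phi>_sum = additive_sum[of \<phi>, OF \<phi>(1)]
  define v where "v = vec r (\<lambda>i. \<phi> (e $ i))"
  have v: "v \<in> V" and vi: "\<And>i. i < r \<Longrightarrow> v $ i = \<phi> (e $ i)" by (simp_all add: v_def)
  have IQ: "x \<in> \<rat>" if "x \<in> \<int>" for x :: real using that Ints_subset_Rats by blast
  \<comment> \<open>\<open>\<phi>\<close> is linear over the rational numbers, so it commutes with the integral matrices.\<close>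
  have fix_v: "act g v = v" if "g \<in> U" for g
  proof (rule eq_vecI)
    have g: "g \<in> carrier G" "multiplier g = 1" using that by (auto simp: U_def)
    fix i assume "i < dim_vec v"
    then have i: "i < r" by (simp add: v_def)
    have "act g v $ i = (\<Sum>j<r. \<rho> g $$ (i, j) * \<phi> (e $ j))"
      unfolding act_sum[OF g(1) v i] by (intro sum.cong) (auto simp: vi)
    also have "\<dots> = (\<Sum>j<r. \<phi> (\<rho> g $$ (i, j) * e $ j))"
      by (intro sum.cong refl) (use \<phi>(2) IQ rho_integral[OF g(1) i] in auto)
    also have "\<dots> = \<phi> (act g e $ i)"
      unfolding \<phi>_sum[symmetric] act_sum[OF g(1) e_carrier i] ..
    also have "act g e = e" using act_e[OF g(1)] g(2) by simp
    finally show "act g v $ i = v $ i" by (simp add: vi[OF i])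
  next
    have "g \<in> carrier G" using that by (simp add: U_def)
    then have "act g v \<in> V" using v by simp
    then show "dim_vec (act g v) = dim_vec v" using v by (metis carrier_vecD)
  qed
  have not_pos: "bil z z \<le> 0" if z: "z \<in> V" and fz: "\<And>g. g \<in> U \<Longrightarrow> act g z = z" for z
  proof (rule ccontr)
    assume "\<not> bil z z \<le> 0"
    then have "finite U"
      using z fz by (intro finite_of_bounded_displacement[of z U "bil z z"]) (auto simp: U_def)
    then show False using inf by (simp add: U_def)
  qed
  have ve: "bil v e = 0"
  proof (rule ccontr)
    assume ne: "bil v e \<noteq> 0"
    \<comment> \<open>This \<open>t\<close> makes the norm of the fixed vector \<open>v + t e\<close> equal to \<open>1\<close>.\<close>
    define t where "t = (1 - bil v v) / (2 * bil v e)"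
    have "bil (v + t \<cdot>\<^sub>v e) (v + t \<cdot>\<^sub>v e) \<le> 0"
    proof (rule not_pos)
      fix g assume "g \<in> U"
      then have g: "g \<in> carrier G" "multiplier g = 1" by (auto simp: U_def)
      then have "act g e = e" using act_e[OF g(1)] by simp
      then show "act g (v + t \<cdot>\<^sub>v e) = v + t \<cdot>\<^sub>v e"
        using g v fix_v[OF \<open>g \<in> U\<close>] by (simp add: act_add act_smult)
    qed (use v in simp)
    moreover have "bil (v + t \<cdot>\<^sub>v e) (v + t \<cdot>\<^sub>v e) = bil v v + 2 * t * bil v e"
      using v e_isotropic bil_commute[OF e_carrier v] by (simp add: bil_linear)
    moreover have "2 * t * bil v e = 1 - bil v v" using ne by (simp add: t_def)
    ultimately show False by simp
  qed
  have "bil v v = (\<Sum>i<r. v $ i * (\<Sum>j<r. M $$ (i, j) * \<phi> (e $ j)))"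
    unfolding bil_sum[OF v v] by (intro sum.cong refl arg_cong2[where f = "(*)"]) (auto simp: vi)
  also have "\<dots> = \<phi> (\<Sum>i<r. v $ i * (\<Sum>j<r. M $$ (i, j) * e $ j))"
  proof -
    have "\<phi> (v $ i * (\<Sum>j<r. M $$ (i, j) * e $ j)) = v $ i * (\<Sum>j<r. M $$ (i, j) * \<phi> (e $ j))" if i: "i < r" for i
    proof -
      have "\<phi> (\<Sum>j<r. M $$ (i, j) * e $ j) = (\<Sum>j<r. M $$ (i, j) * \<phi> (e $ j))"
        unfolding \<phi>_sum by (intro sum.cong refl) (use \<phi>(2) IQ M_integral[OF i] in auto)
      then show ?thesis using \<phi>(2)[of "v $ i"] \<phi>(3) vi[OF i] by simp
    qed
    then show ?thesis unfolding \<phi>_sum[of _ "{..<r}"] by simp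
  qed
  also have "\<dots> = \<phi> (bil v e)" unfolding bil_sum[OF v e_carrier] ..
  also have "\<dots> = 0" using ve \<phi>(1)[of 0 0] by simp
  finally have vv: "bil v v = 0" .
  obtain a where a: "v = a \<cdot>\<^sub>v e"
    using isotropic_orthogonal_proportional[OF e_carrier e_nonzero e_isotropic v vv] ve bil_commute[OF v e_carrier] by auto
  obtain d :: nat where d: "0 < d" "\<And>i. i < r \<Longrightarrow> real d * v $ i \<in> \<int>"
    using common_denominator[of r "\<lambda>i. v $ i"] vi \<phi>(3) by metis
  show ?thesis
  proof (rule that[of "real d \<cdot>\<^sub>v v"])
    show "real d \<cdot>\<^sub>v v \<in> V" using v by simp
    have "v $ i0 \<noteq> 0" using i0 \<phi>(4) by (simp add: vi)
    then have "(real d \<cdot>\<^sub>v v) $ i0 \<noteq> 0" using d(1) i0(1) by (simp add: v_def)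
    then show "real d \<cdot>\<^sub>v v \<noteq> 0\<^sub>v r" using i0(1) by auto
    show "bil (real d \<cdot>\<^sub>v v) (real d \<cdot>\<^sub>v v) = 0" using v vv by simp
    show "(real d \<cdot>\<^sub>v v) $ i \<in> \<int>" if "i < r" for i using d(2)[OF that] that by (simp add: v_def)
    show "act g (real d \<cdot>\<^sub>v v) = multiplier g \<cdot>\<^sub>v (real d \<cdot>\<^sub>v v)" if "g \<in> carrier G" for g
      unfolding a using that by (simp add: act_smult act_e smult_smult_assoc ac_simps)
  qed
qed

lemma bil_unit: "x \<in> V \<Longrightarrow> i < r \<Longrightarrow> bil x (unit_vec r i) = (M *\<^sub>v x) $ i"
  using bil_commute[of x "unit_vec r i"] unfolding bil_def
  by (simp add: scalar_prod_left_unit del: index_mult_mat_vec)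

lemma zero_of_orthogonal_to_units:
  assumes x: "x \<in> V" and "\<And>i. i < r \<Longrightarrow> bil x (unit_vec r i) = 0"
  shows "x = 0\<^sub>v r"
proof (rule bil_nondegenerate[OF _ x])
  fix y assume y: "y \<in> V"
  have "M *\<^sub>v x = 0\<^sub>v r"
    using assms bil_unit[OF x] carrier_vecD[OF M_mult_carrier[OF x]] by (intro eq_vecI) (auto simp del: index_mult_mat_vec)
  then show "bil x y = 0" using bil_commute[OF x y] y by (simp add: bil_def)
qed

lemma bil_integral:
  assumes "x \<in> V" "y \<in> V" "\<And>i. i < r \<Longrightarrow> x $ i \<in> \<int>" "\<And>i. i < r \<Longrightarrow> y $ i \<in> \<int>"
  shows "bil x y \<in> \<int>"
  unfolding bil_sum[OF assms(1,2)] using assms(3,4) M_integral by (intro Ints_sum Ints_mult) auto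

lemma act_integral:
  assumes "g \<in> carrier G" "x \<in> V" "\<And>i. i < r \<Longrightarrow> x $ i \<in> \<int>" "i < r"
  shows "act g x $ i \<in> \<int>"
  unfolding act_sum[OF assms(1,2,4)] using assms(3,4) rho_integral[OF assms(1)] by (intro Ints_sum Ints_mult) auto

text \<open>The group acts on the complement of the integral isotropic vector \<open>w\<close> modulo \<open>w\<close>, where the
  form is negative definite, so the image of this action is finite. Let \<open>A\<close> consist of the elements of its
  kernel that fix \<open>w\<close>. They shift each vector of the complement by a multiple of \<open>w\<close>; this multiple is additive in the group
  element, and an isometry that shifts nothing is trivial.\<close>

lemma virtually_finite_by_lattice_of_parabolic:
  assumes unimodular: "\<And>g. g \<in> carrier G \<Longrightarrow> \<bar>multiplier g\<bar> = 1"
    and w: "w \<in> V" "w \<noteq> 0\<^sub>v r" "bil w w = 0" "\<And>i. i < r \<Longrightarrow> w $ i \<in> \<int>"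
      "\<And>g. g \<in> carrier G \<Longrightarrow> act g w = multiplier g \<cdot>\<^sub>v w"
  shows "virtually_finite_by_lattice G"
proof -
  let ?u = "\<lambda>j. unit_vec r j :: real vec"
  define b where "b j = bil (?u j) w" for j
  obtain i0 where i0: "i0 < r" "b i0 \<noteq> 0"
    using zero_of_orthogonal_to_units[OF w(1)] w(2) bil_commute[OF w(1), of "?u _"] unfolding b_def
    by (metis unit_vec_carrier)
  obtain i1 where i1: "i1 < r" "w $ i1 \<noteq> 0"
    using w(1,2) by (metis carrier_vecD eq_vecI index_zero_vec)
  define x where "x j = b i0 \<cdot>\<^sub>v ?u j - b j \<cdot>\<^sub>v ?u i0" for j
  have x: "x j \<in> V" for j by (simp add: x_def)
  have xw: "bil (x j) w = 0" for j
    using w(1) by (simp add: x_def bil_minus_left) (simp add: b_def)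
  have b_int: "b j \<in> \<int>" if "j < r" for j
    unfolding b_def using w(1,4) that by (intro bil_integral) auto
  have x_int: "x j $ i \<in> \<int>" if "j < r" "i < r" for i j
    using b_int[OF that(1)] b_int[OF i0(1)] that i0(1) by (auto simp: x_def intro!: Ints_diff Ints_mult)
  \<comment> \<open>The integral vectors \<open>x j\<close> span the complement of \<open>w\<close>, so only the line of \<open>w\<close> is orthogonal
    to all of them.\<close>
  have orth: "\<exists>c. z = c \<cdot>\<^sub>v w" if z: "z \<in> V" and zx: "\<And>j. j < r \<Longrightarrow> bil z (x j) = 0" for z
  proof -
    define c where "c = bil z (?u i0) / b i0"
    have "z - c \<cdot>\<^sub>v w = 0\<^sub>v r"
    proof (rule zero_of_orthogonal_to_units)
      fix j assume j: "j < r"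
      have "b i0 * bil z (?u j) = b j * bil z (?u i0)"
        using zx[OF j] z by (simp add: x_def bil_minus_right)
      then have "bil z (?u j) = c * b j" using i0(2) by (simp add: c_def field_simps)
      moreover have "bil w (?u j) = b j" using bil_commute[OF w(1), of "?u j"] by (simp add: b_def)
      ultimately show "bil (z - c \<cdot>\<^sub>v w) (?u j) = 0" using z w(1) by (simp add: bil_minus_left)
    qed (use z w(1) in simp)
    then have "(z - c \<cdot>\<^sub>v w) $ i = 0" if "i < r" for i using that by simp
    then have "z = c \<cdot>\<^sub>v w" using z w(1) by (intro eq_vecI) auto
    then show ?thesis by blast
  qed
  define A where "A = {g \<in> carrier G. multiplier g = 1 \<and> (\<forall>j<r. \<exists>c. act g (x j) = x j + c \<cdot>\<^sub>v w)}"
  have A_carrier: "g \<in> carrier G" and A_w: "act g w = w" if "g \<in> A" for g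
    using that w(5)[of g] w(1) by (auto simp: A_def)
  have A_x: "\<exists>c. act g (x j) = x j + c \<cdot>\<^sub>v w" if "g \<in> A" "j < r" for g j
    using that by (auto simp: A_def)
  have A_mult: "act (g \<otimes> h) (x j) = x j + (c + d) \<cdot>\<^sub>v w"
    if g: "g \<in> A" and h: "h \<in> A" and gc: "act g (x j) = x j + c \<cdot>\<^sub>v w" and hd: "act h (x j) = x j + d \<cdot>\<^sub>v w" for g h j c d
  proof -
    have "act (g \<otimes> h) (x j) = act g (x j) + d \<cdot>\<^sub>v act g w"
      using A_carrier[OF g] A_carrier[OF h] x w(1) hd by (simp add: act_mult act_add act_smult)
    also have "\<dots> = x j + (c \<cdot>\<^sub>v w + d \<cdot>\<^sub>v w)"
      unfolding gc A_w[OF g] using x w(1) by (intro assoc_add_vec[of _ r]) auto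
    finally show ?thesis by (simp add: add_smult_distrib_vec)
  qed
  have A_subgroup: "subgroup A G"
  proof (rule subgroupI)
    have "act \<one> (x j) = x j + 0 \<cdot>\<^sub>v w" for j
      using x[of j] w(1) by (intro eq_vecI) (auto simp: rho_one)
    then have "\<one> \<in> A" by (auto simp: A_def multiplier_one)
    then show "A \<noteq> {}" by blast
  next
    fix g assume g: "g \<in> A"
    have "\<exists>c. act (inv g) (x j) = x j + c \<cdot>\<^sub>v w" if j: "j < r" for j
    proof -
      obtain c where c: "act g (x j) = x j + c \<cdot>\<^sub>v w" using A_x[OF g j] by blast
      have iw: "act (inv g) w = w" using act_inv(2)[OF A_carrier[OF g] w(1)] A_w[OF g] by simp
      have "x j = act (inv g) (act g (x j))" using A_carrier[OF g] x by simp
      also have "\<dots> = act (inv g) (x j) + c \<cdot>\<^sub>v w"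
        using A_carrier[OF g] x w(1) by (simp add: c act_add act_smult iw)
      finally have eq: "x j = act (inv g) (x j) + c \<cdot>\<^sub>v w" .
      have "act (inv g) (x j) = x j + (- c) \<cdot>\<^sub>v w"
      proof (rule eq_vecI)
        have dims: "dim_vec (act (inv g) (x j)) = r" "dim_vec w = r" "dim_vec (x j) = r"
          using carrier_vecD[OF act_carrier[of "inv g" "x j"]] A_carrier[OF g] x w(1) carrier_vecD by auto
        then show "dim_vec (act (inv g) (x j)) = dim_vec (x j + (- c) \<cdot>\<^sub>v w)" by simp
        fix i assume "i < dim_vec (x j + (- c) \<cdot>\<^sub>v w)"
        then have "i < r" using dims by simp
        moreover have "x j $ i = (act (inv g) (x j) + c \<cdot>\<^sub>v w) $ i" using eq by simp
        ultimately show "act (inv g) (x j) $ i = (x j + (- c) \<cdot>\<^sub>v w) $ i"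
          using dims by (simp del: index_mult_mat_vec)
      qed
      then show ?thesis by blast
    qed
    moreover have "multiplier (inv g) = 1" using multiplier_inv[of g] g by (simp add: A_def)
    ultimately show "inv g \<in> A" using A_carrier[OF g] by (simp add: A_def)
  next
    fix g h assume g: "g \<in> A" and h: "h \<in> A"
    have "\<exists>c. act (g \<otimes> h) (x j) = x j + c \<cdot>\<^sub>v w" if j: "j < r" for j
      using A_x[OF g j] A_x[OF h j] A_mult[OF g h] by blast
    moreover have "multiplier (g \<otimes> h) = 1" using g h by (simp add: A_def multiplier_mult)
    ultimately show "g \<otimes> h \<in> A" using A_carrier[OF g] A_carrier[OF h] by (simp add: A_def)
  qed (auto simp: A_def)
  \<comment> \<open>On the complement of \<open>w\<close> the form is negative semidefinite, so the Gram matrix of the translates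
    of the \<open>x j\<close> against the \<open>x k\<close> takes finitely many values. Together with the
    multiplier it determines the coset of \<open>A\<close>.\<close>
  define \<tau> where "\<tau> g = (multiplier g, \<lambda>p \<in> {..<r} \<times> {..<r}. bil (act (inv g) (x (fst p))) (x (snd p)))" for g
  define B where "B = (\<Sum>j<r. \<Sum>k<r. bil (x j) (x j) * bil (x k) (x k))"
  have nonneg: "0 \<le> bil (x j) (x j) * bil (x k) (x k)" for j k
    using isotropic_orthogonal_complement[OF w(1,2,3) x[of j] xw x[of k] xw] by (metis order_trans zero_le_power2)
  have bound: "\<bar>bil (act (inv g) (x j)) (x k)\<bar> \<le> sqrt B" if g: "g \<in> carrier G" and jk: "j < r" "k < r" for g j k
  proof -
    have "bil (act (inv g) (x j)) w = bil (x j) (act g w)"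
      using bil_act_left[of "inv g" "x j" w] g x w(1) by simp
    then have perp: "bil (act (inv g) (x j)) w = 0" using w(1,5) g x xw by simp
    have "(bil (act (inv g) (x j)) (x k))\<^sup>2 \<le> bil (act (inv g) (x j)) (act (inv g) (x j)) * bil (x k) (x k)"
      using isotropic_orthogonal_complement[OF w(1,2,3) _ perp x xw] g x by simp
    also have "\<dots> = bil (x j) (x j) * bil (x k) (x k)" using rho_isometry[of "inv g"] g x by simp
    also have "\<dots> \<le> (\<Sum>k<r. bil (x j) (x j) * bil (x k) (x k))"
      using jk nonneg by (intro member_le_sum[of k _ "\<lambda>k. bil (x j) (x j) * bil (x k) (x k)"]) auto
    also have "\<dots> \<le> B" unfolding B_def
      using jk nonneg by (intro member_le_sum[of j _ "\<lambda>j. \<Sum>k<r. bil (x j) (x j) * bil (x k) (x k)"]) (auto intro: sum_nonneg)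
    finally show ?thesis using real_le_rsqrt[of "\<bar>bil (act (inv g) (x j)) (x k)\<bar>" B] by simp
  qed
  have A_index: "finite_index G A"
  proof (rule finite_index_of_invariant[OF A_subgroup, where \<tau> = \<tau>])
    let ?F = "PiE ({..<r} \<times> {..<r}) (\<lambda>_. {k \<in> \<int>. \<bar>k :: real\<bar> \<le> sqrt B})"
    have "\<tau> ` carrier G \<subseteq> {1, -1} \<times> ?F"
    proof
      fix t assume "t \<in> \<tau> ` carrier G"
      then obtain g where g: "g \<in> carrier G" "t = \<tau> g" by blast
      have "multiplier g \<in> {1, -1}" using unimodular[OF g(1)] by auto
      moreover have "bil (act (inv g) (x j)) (x k) \<in> \<int>" if "j < r" "k < r" for j k
        using g(1) x x_int act_integral[of "inv g" "x j"] that by (intro bil_integral) auto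
      ultimately show "t \<in> {1, -1} \<times> ?F" using g(2) bound[OF g(1)] by (auto simp: \<tau>_def)
    qed
    moreover have "finite ({1, -1 :: real} \<times> ?F)"
      by (intro finite_cartesian_product finite_PiE) (auto simp: finite_abs_int_segment)
    ultimately show "finite (\<tau> ` carrier G)" by (rule finite_subset)
  next
    fix g h assume g: "g \<in> carrier G" and h: "h \<in> carrier G" and eq: "\<tau> g = \<tau> h"
    have mult: "multiplier g = multiplier h" using eq by (simp add: \<tau>_def)
    have tup: "bil (act (inv g) (x j)) (x k) = bil (act (inv h) (x j)) (x k)" if "j < r" "k < r" for j k
    proof -
      have "snd (\<tau> g) (j, k) = snd (\<tau> h) (j, k)" using eq by simp
      then show ?thesis using that by (simp add: \<tau>_def)
    qed
    have "\<exists>c. act (g \<otimes> inv h) (x j) = x j + c \<cdot>\<^sub>v w" if j: "j < r" for j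
    proof -
      have "\<exists>c. act (inv h) (x j) - act (inv g) (x j) = c \<cdot>\<^sub>v w"
        using tup[OF j] g h x by (intro orth) (auto simp: bil_minus_left)
      then obtain c where c: "act (inv h) (x j) - act (inv g) (x j) = c \<cdot>\<^sub>v w" by blast
      have "act g (act (inv h) (x j) - act (inv g) (x j)) = act (g \<otimes> inv h) (x j) - x j"
        using g h x by (simp add: act_minus act_mult)
      then have "act (g \<otimes> inv h) (x j) - x j = (c * multiplier g) \<cdot>\<^sub>v w"
        using g w(1,5) by (simp add: c act_smult smult_smult_assoc)
      moreover have "act (g \<otimes> inv h) (x j) = x j + (act (g \<otimes> inv h) (x j) - x j)"
      proof (rule eq_vecI)
        have d: "dim_vec (act (g \<otimes> inv h) (x j)) = r" "dim_vec (x j) = r"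
          using carrier_vecD[OF act_carrier[of "g \<otimes> inv h" "x j"]] g h x carrier_vecD by auto
        then show "dim_vec (act (g \<otimes> inv h) (x j)) = dim_vec (x j + (act (g \<otimes> inv h) (x j) - x j))" by simp
        show "act (g \<otimes> inv h) (x j) $ i = (x j + (act (g \<otimes> inv h) (x j) - x j)) $ i"
          if "i < dim_vec (x j + (act (g \<otimes> inv h) (x j) - x j))" for i
          using that d by (simp del: index_mult_mat_vec)
      qed
      ultimately show ?thesis by metis
    qed
    moreover have "multiplier (g \<otimes> inv h) = 1"
      using multiplier_mult[of g "inv h"] multiplier_inv[OF h] mult g h by simp
    ultimately show "g \<otimes> inv h \<in> A" using g h by (simp add: A_def)
  qed
  \<comment> \<open>The entry at a place \<open>i1\<close> where \<open>w\<close> does not vanish measures the multiple of \<open>w\<close> by an integer.\<close>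
  define \<psi> :: "_ \<Rightarrow> nat \<Rightarrow> int" where "\<psi> g j = \<lfloor>act g (x j) $ i1 - x j $ i1\<rfloor>" for g j
  have \<psi>: "real_of_int (\<psi> g j) = c * w $ i1" if g: "g \<in> A" and j: "j < r" and c: "act g (x j) = x j + c \<cdot>\<^sub>v w" for g j c
  proof -
    have "act g (x j) $ i1 - x j $ i1 \<in> \<int>"
      using act_integral[OF A_carrier[OF g] x] x_int j i1(1) by (intro Ints_diff) auto
    then have "real_of_int (\<psi> g j) = act g (x j) $ i1 - x j $ i1" by (simp add: \<psi>_def)
    also have "\<dots> = c * w $ i1" unfolding c using x[of j] w(1) i1(1) by simp
    finally show ?thesis .
  qed
  have \<psi>_add: "\<psi> (g \<otimes> h) j = \<psi> g j + \<psi> h j" if g: "g \<in> A" and h: "h \<in> A" and j: "j < r" for g h j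
  proof -
    obtain c d where c: "act g (x j) = x j + c \<cdot>\<^sub>v w" and d: "act h (x j) = x j + d \<cdot>\<^sub>v w"
      using A_x[OF g j] A_x[OF h j] by blast
    have "real_of_int (\<psi> (g \<otimes> h) j) = (c + d) * w $ i1"
      using \<psi>[OF subgroup.m_closed[OF A_subgroup g h] j A_mult[OF g h c d]] .
    also have "\<dots> = real_of_int (\<psi> g j + \<psi> h j)"
      using \<psi>[OF g j c] \<psi>[OF h j d] by (simp add: distrib_right)
    finally show ?thesis by linarith
  qed
  have "{g \<in> A. \<forall>j<r. \<psi> g j = 0} \<subseteq> {\<one>}"
  proof
    fix g assume "g \<in> {g \<in> A. \<forall>j<r. \<psi> g j = 0}"
    then have gA: "g \<in> A" and \<psi>0: "\<And>j. j < r \<Longrightarrow> \<psi> g j = 0" by auto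
    note g = A_carrier[OF gA]
    have fix_x: "act g (x j) = x j" if j: "j < r" for j
    proof -
      obtain c where c: "act g (x j) = x j + c \<cdot>\<^sub>v w" using A_x[OF gA j] by blast
      then have "c = 0" using \<psi>[OF gA j c] \<psi>0[OF j] i1(2) by simp
      then show ?thesis unfolding c using x[of j] w(1) by (intro eq_vecI) auto
    qed
    \<comment> \<open>The vector \<open>?u i0\<close> is outside the complement. It can only be shifted along \<open>w\<close>, and such a shift
      would change its norm.\<close>
    have "\<exists>c. act g (?u i0) - ?u i0 = c \<cdot>\<^sub>v w"
    proof (rule orth)
      fix j assume "j < r"
      then have "bil (act g (?u i0)) (x j) = bil (?u i0) (x j)"
        using rho_isometry[OF g, of "?u i0" "x j"] x fix_x by simp
      then show "bil (act g (?u i0) - ?u i0) (x j) = 0" using g x by (simp add: bil_minus_left)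
    qed (use g in simp)
    then obtain c where "act g (?u i0) - ?u i0 = c \<cdot>\<^sub>v w" by blast
    then have diff: "act g (?u i0) $ i - ?u i0 $ i = (c \<cdot>\<^sub>v w) $ i" if "i < r" for i
      using index_minus_vec(1)[of i "?u i0" "act g (?u i0)"] that by simp
    have c: "act g (?u i0) = ?u i0 + c \<cdot>\<^sub>v w"
    proof (rule eq_vecI)
      show "dim_vec (act g (?u i0)) = dim_vec (?u i0 + c \<cdot>\<^sub>v w)"
        using carrier_vecD[OF act_carrier[OF g, of "?u i0"]] carrier_vecD[OF w(1)] by simp
      fix i assume "i < dim_vec (?u i0 + c \<cdot>\<^sub>v w)"
      then have i: "i < r" using carrier_vecD[OF w(1)] by simp
      have "act g (?u i0) $ i = ?u i0 $ i + (c \<cdot>\<^sub>v w) $ i" using diff[OF i] by linarith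
      then show "act g (?u i0) $ i = (?u i0 + c \<cdot>\<^sub>v w) $ i" using i carrier_vecD[OF w(1)] by simp
    qed
    have "bil (?u i0 + c \<cdot>\<^sub>v w) (?u i0 + c \<cdot>\<^sub>v w) = bil (?u i0) (?u i0)"
      using rho_isometry[OF g, of "?u i0" "?u i0"] by (simp flip: c)
    then have "c * b i0 = 0"
      using w(1,3) bil_commute[OF w(1), of "?u i0"] by (simp add: bil_linear b_def)
    then have "c = 0" using i0(2) by simp
    then have u0: "act g (?u i0) = ?u i0" unfolding c using w(1) by (intro eq_vecI) auto
    have u: "act g (?u j) = ?u j" if j: "j < r" for j
    proof (rule eq_vecI)
      have d: "dim_vec (act g (?u j)) = r" using carrier_vecD[OF act_carrier[OF g, of "?u j"]] by simp
      then show "dim_vec (act g (?u j)) = dim_vec (?u j)" by simp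
      fix i assume "i < dim_vec (?u j)"
      then have i: "i < r" by simp
      have "b i0 \<cdot>\<^sub>v act g (?u j) - b j \<cdot>\<^sub>v ?u i0 = x j"
        using fix_x[OF j] g by (simp add: x_def act_minus act_smult u0)
      then have "(b i0 \<cdot>\<^sub>v act g (?u j) - b j \<cdot>\<^sub>v ?u i0) $ i = (b i0 \<cdot>\<^sub>v ?u j - b j \<cdot>\<^sub>v ?u i0) $ i"
        by (simp add: x_def)
      then show "act g (?u j) $ i = ?u j $ i"
        using i d i0 j by (simp del: index_mult_mat_vec)
    qed
    have "\<rho> g = 1\<^sub>m r"
    proof (rule eq_matI)
      fix i j assume "i < dim_row (1\<^sub>m r :: real mat)" "j < dim_col (1\<^sub>m r :: real mat)"
      then have ij: "i < r" "j < r" by auto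
      have "\<rho> g $$ (i, j) = act g (?u j) $ i" using rho_carrier[OF g] ij by simp
      then show "\<rho> g $$ (i, j) = 1\<^sub>m r $$ (i, j)" using u[OF ij(2)] ij by simp
    qed (use rho_carrier[OF g] in auto)
    then show "g \<in> {\<one>}" using inj_onD[OF rho_inj, of g \<one>] rho_one g by simp
  qed
  then have "finite {g \<in> A. \<forall>j<r. \<psi> g j = 0}" by (rule finite_subset) simp
  then show ?thesis
    unfolding virtually_finite_by_lattice_def using A_subgroup A_index \<psi>_add by blast
qed

theorem virtually_finite_by_lattice_of_fixed_line: "virtually_finite_by_lattice G"
proof (cases "\<exists>h \<in> carrier G. \<bar>multiplier h\<bar> \<noteq> 1")
  case True
  then show ?thesis using virtually_finite_by_lattice_of_loxodromic by blast
next
  case False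
  then have unimodular: "\<bar>multiplier g\<bar> = 1" if "g \<in> carrier G" for g using that by blast
  let ?U = "{g \<in> carrier G. multiplier g = 1}"
  show ?thesis
  proof (cases "finite ?U")
    case True
    have U: "subgroup ?U G"
    proof (rule subgroupI)
      show "inv g \<in> ?U" if "g \<in> ?U" for g using that multiplier_inv[of g] by simp
    qed (use multiplier_one in \<open>auto simp: multiplier_mult\<close>)
    have "finite_index G ?U"
    proof (rule finite_index_of_invariant[OF U, where \<tau> = multiplier])
      have "multiplier ` carrier G \<subseteq> {1, -1}" using unimodular by (force simp: abs_if split: if_splits)
      then show "finite (multiplier ` carrier G)" by (rule finite_subset) simp
      show "g \<otimes> inv h \<in> ?U" if "g \<in> carrier G" "h \<in> carrier G" "multiplier g = multiplier h" for g h
        using that multiplier_inv[of h] by (simp add: multiplier_mult)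
    qed
    then show ?thesis
      unfolding virtually_finite_by_lattice_def using U True
      by (intro exI[of _ ?U] exI[of _ 0] exI[of _ "\<lambda>_ _. 0"]) simp
  next
    case False
    obtain w where "w \<in> V" "w \<noteq> 0\<^sub>v r" "bil w w = 0" "\<And>i. i < r \<Longrightarrow> w $ i \<in> \<int>"
      "\<And>g. g \<in> carrier G \<Longrightarrow> act g w = multiplier g \<cdot>\<^sub>v w"
      using integral_fixed_vector[OF False] by blast
    then show ?thesis using virtually_finite_by_lattice_of_parabolic unimodular by blast
  qed
qed

end

context integral_lorentz_action
begin

text \<open>Let \<open>D\<close> be the last infinite member of the derived series. It is normal, and its commutators lie in the next
  member, which is finite.\<close>

theorem virtually_finite_by_lattice_of_solvable:
  assumes "solvable G"
  shows "virtually_finite_by_lattice G"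
proof (cases "finite (carrier G)")
  case True
  show ?thesis
    unfolding virtually_finite_by_lattice_def using True subgroup_self finite_index_carrier
    by (intro exI[of _ "carrier G"] exI[of _ 0] exI[of _ "\<lambda>_ _. 0"]) simp
next
  case False
  define D where "D n = (derived G ^^ n) (carrier G)" for n
  obtain n where n: "D n = {\<one>}" using assms solvable_iff_trivial_derived_seq by (auto simp: D_def)
  have normal: "D n \<lhd> G" for n
    unfolding D_def by (induction n) (auto simp: normal_self derived_is_normal)
  have "\<exists>k. infinite (D k) \<and> finite (D (Suc k))"
  proof (rule ccontr)
    assume "\<nexists>k. infinite (D k) \<and> finite (D (Suc k))"
    then have "infinite (D k)" for k by (induction k) (use False in \<open>auto simp: D_def\<close>)
    then show False using n by (metis finite.emptyI finite.insertI)
  qed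
  then obtain k where k: "infinite (D k)" "finite (D (Suc k))" by blast
  interpret N: normal "D k" G by (rule normal)
  have Dk: "D k \<subseteq> carrier G" by (rule N.subset)
  have F: "D (Suc k) = derived G (D k)" by (simp add: D_def)
  have FG: "D (Suc k) \<subseteq> carrier G" unfolding F by (rule derived_in_carrier[OF Dk])
  have comm: "inv h \<otimes> inv a \<otimes> h \<otimes> a \<in> D (Suc k)" if a: "a \<in> D k" and h: "h \<in> D k" for a h
  proof -
    have "inv h \<otimes> inv a \<otimes> inv (inv h) \<otimes> inv (inv a) \<in> derived_set G (D k)"
      using N.m_inv_closed[OF a] N.m_inv_closed[OF h] by blast
    then have "inv h \<otimes> inv a \<otimes> inv (inv h) \<otimes> inv (inv a) \<in> D (Suc k)"
      unfolding F derived_def by (rule generate.incl)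
    then show ?thesis using a h Dk by (simp add: subset_iff)
  qed
  obtain e where e: "e \<in> V" "e \<noteq> 0\<^sub>v r" "bil e e = 0" "finite_index G {g \<in> carrier G. \<exists>\<mu>. act g e = \<mu> \<cdot>\<^sub>v e}"
    using infinite_normal_almost_commutative_subgroup_fixes_line[OF k(1) Dk _ k(2) FG comm] N.inv_op_closed2 by blast
  let ?S = "{g \<in> carrier G. \<exists>\<mu>. act g e = \<mu> \<cdot>\<^sub>v e}"
  have S: "subgroup ?S G" by (rule subgroup_fixing_line[OF e(1,2)])
  have "line_fixing_action r M (G\<lparr>carrier := ?S\<rparr>) \<rho> e"
    unfolding line_fixing_action_def line_fixing_action_axioms_def
    using restrict_to_subgroup[OF S] e by auto
  then have "virtually_finite_by_lattice (G\<lparr>carrier := ?S\<rparr>)"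
    by (rule line_fixing_action.virtually_finite_by_lattice_of_fixed_line)
  then show ?thesis using virtually_finite_by_lattice_of_subgroup[OF S e(4)] by blast
qed

end

section \<open>Isometries of a hyperbolic lattice as integral matrices\<close>

text \<open>In the basis given by \<open>\<phi>\<close>, an isometry of the lattice is an integral matrix that preserves the
  Gram matrix.\<close>

locale based_hyperbolic_lattice = integral_lattice L B r
  for L :: "('a, 'b) monoid_scheme" (structure) and B r +
  fixes \<phi> :: "(nat \<Rightarrow>\<^sub>0 int) \<Rightarrow> 'a"
  assumes phi: "\<phi> \<in> iso (Z_power r) L"
    and signature: "matrix_signature (gram_matrix B r \<phi>) = (1, 0, r - 1)"
begin

abbreviation Z where "Z \<equiv> carrier (Z_power r)"

abbreviation basis where "basis i \<equiv> \<phi> (frag_of i)"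

definition coeff :: "'a \<Rightarrow> nat \<Rightarrow> int" where
  "coeff x = Poly_Mapping.lookup (inv_into Z \<phi> x)"

lemma bij: "bij_betw \<phi> Z (carrier L)"
  using phi by (simp add: iso_def)

lemma phi_closed [simp]: "c \<in> Z \<Longrightarrow> \<phi> c \<in> carrier L"
  using bij bij_betwE by blast

lemma phi_add: "c \<in> Z \<Longrightarrow> d \<in> Z \<Longrightarrow> \<phi> (c + d) = \<phi> c \<otimes> \<phi> d"
  using phi by (auto simp: iso_def hom_def)

lemma basis_closed [simp]: "i < r \<Longrightarrow> basis i \<in> carrier L"
  by (rule phi_closed) simp

lemma coeff_phi: "c \<in> Z \<Longrightarrow> coeff (\<phi> c) = Poly_Mapping.lookup c"
  unfolding coeff_def using bij by (simp add: bij_betw_inv_into_left)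

lemma coeff_basis: "i < r \<Longrightarrow> coeff (basis i) j = (if i = j then 1 else 0)"
  by (subst coeff_phi) auto

lemma lattice_element:
  assumes "x \<in> carrier L"
  obtains c where "c \<in> Z" "x = \<phi> c"
proof -
  have "x \<in> \<phi> ` Z" using assms bij_betw_imp_surj_on[OF bij] by simp
  then show ?thesis using that by blast
qed

lemma coeff_mult:
  assumes "x \<in> carrier L" "y \<in> carrier L"
  shows "coeff (x \<otimes> y) i = coeff x i + coeff y i"
proof -
  obtain c d where cd: "c \<in> Z" "d \<in> Z" "x = \<phi> c" "y = \<phi> d"
    using lattice_element assms by metis
  have "Poly_Mapping.keys (c + d) \<subseteq> {..<r}" using keys_add[of c d] cd(1,2) by auto
  then have "c + d \<in> Z" by simp
  then show ?thesis using cd by (simp add: coeff_phi lookup_add flip: phi_add)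
qed

lemma eq_of_coeff_eq:
  assumes "x \<in> carrier L" "y \<in> carrier L" "\<And>i. i < r \<Longrightarrow> coeff x i = coeff y i"
  shows "x = y"
proof -
  obtain c d where cd: "c \<in> Z" "d \<in> Z" "x = \<phi> c" "y = \<phi> d"
    using lattice_element assms by metis
  have "Poly_Mapping.lookup c i = Poly_Mapping.lookup d i" for i
  proof (cases "i < r")
    case True
    then show ?thesis using assms(3)[OF True] cd by (simp add: coeff_phi)
  next
    case False
    then have "i \<notin> Poly_Mapping.keys c" "i \<notin> Poly_Mapping.keys d" using cd by auto
    then show ?thesis by (simp add: in_keys_iff)
  qed
  then have "c = d" by (rule poly_mapping_eqI)
  then show ?thesis using cd by simp
qed

text \<open>This is applied to the form, one argument at a time, and to the coordinates of the image of a lattice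
  vector under an isometry.\<close>

lemma additive_on_lattice:
  fixes f :: "'a \<Rightarrow> int"
  assumes f: "\<And>x y. x \<in> carrier L \<Longrightarrow> y \<in> carrier L \<Longrightarrow> f (x \<otimes> y) = f x + f y" and x: "x \<in> carrier L"
  shows "f x = (\<Sum>i<r. coeff x i * f (basis i))"
proof -
  obtain c where c: "c \<in> Z" "x = \<phi> c" by (rule lattice_element[OF x])
  have "Poly_Mapping.keys c \<subseteq> {..<r}" using c(1) by simp
  then have "f (\<phi> c) = (\<Sum>i<r. Poly_Mapping.lookup c i * f (basis i))"
  proof (rule free_Abelian_group_induct[where P = "\<lambda>c. f (\<phi> c) = (\<Sum>i<r. Poly_Mapping.lookup c i * f (basis i))"])
    have "0 \<in> Z" by simp
    then have "f (\<phi> 0) = 0" using f[of "\<phi> 0" "\<phi> 0"] phi_add[of 0 0] by simp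
    then show "f (\<phi> 0) = (\<Sum>i<r. Poly_Mapping.lookup 0 i * f (basis i))" by simp
  next
    fix c d :: "nat \<Rightarrow>\<^sub>0 int"
    assume *: "Poly_Mapping.keys c \<subseteq> {..<r}" "Poly_Mapping.keys d \<subseteq> {..<r}"
      "f (\<phi> c) = (\<Sum>i<r. Poly_Mapping.lookup c i * f (basis i))"
      "f (\<phi> d) = (\<Sum>i<r. Poly_Mapping.lookup d i * f (basis i))"
    have cd: "c \<in> Z" "d \<in> Z" "c - d \<in> Z" using *(1,2) keys_diff[of c d] by auto
    have "f (\<phi> c) = f (\<phi> (c - d)) + f (\<phi> d)"
      using f[OF phi_closed[OF cd(3)] phi_closed[OF cd(2)]] phi_add[OF cd(3,2)] by simp
    then show "f (\<phi> (c - d)) = (\<Sum>i<r. Poly_Mapping.lookup (c - d) i * f (basis i))"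
      using *(3,4) by (simp add: lookup_minus left_diff_distrib sum_subtractf)
  next
    fix a assume a: "a \<in> {..<r}"
    have "(\<Sum>i<r. Poly_Mapping.lookup (frag_of a) i * f (basis i)) = (\<Sum>i<r. if i = a then f (basis i) else 0)"
      by (rule sum.cong) auto
    then show "f (basis a) = (\<Sum>i<r. Poly_Mapping.lookup (frag_of a) i * f (basis i))" using a by simp
  qed
  then show ?thesis using c by (simp add: coeff_phi)
qed

definition mat_of :: "('a \<Rightarrow> 'a) \<Rightarrow> real mat" where
  "mat_of f = mat r r (\<lambda>(i, j). real_of_int (coeff (f (basis j)) i))"

abbreviation gram where "gram \<equiv> gram_matrix B r \<phi>"

lemma gram_carrier: "gram \<in> carrier_mat r r"
  by (simp add: gram_matrix_def)

lemma coeff_image: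
  assumes f: "f \<in> auto L" and x: "x \<in> carrier L"
  shows "coeff (f x) i = (\<Sum>j<r. coeff x j * coeff (f (basis j)) i)"
proof (rule additive_on_lattice[of "\<lambda>x. coeff (f x) i"])
  fix x y assume "x \<in> carrier L" "y \<in> carrier L"
  then show "coeff (f (x \<otimes> y)) i = coeff (f x) i + coeff (f y) i"
    using f by (auto simp: auto_def hom_def coeff_mult Pi_iff)
qed (rule x)

lemma form_coeff:
  assumes x: "x \<in> carrier L" and y: "y \<in> carrier L"
  shows "B x y = (\<Sum>i<r. coeff x i * (\<Sum>j<r. B (basis i) (basis j) * coeff y j))"
proof -
  have add2: "B z (u \<otimes> v) = B z u + B z v" if "z \<in> carrier L" "u \<in> carrier L" "v \<in> carrier L" for z u v
    using that form_add[of u v z] form_sym by simp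
  have "B x y = (\<Sum>i<r. coeff x i * B (basis i) y)"
    by (rule additive_on_lattice[of "\<lambda>x. B x y", OF form_add[OF _ _ y] x])
  also have "\<dots> = (\<Sum>i<r. coeff x i * (\<Sum>j<r. B (basis i) (basis j) * coeff y j))"
  proof (intro sum.cong refl arg_cong2[where f = "(*)"])
    fix i assume "i \<in> {..<r}"
    then have "basis i \<in> carrier L" by simp
    from additive_on_lattice[of "\<lambda>y. B (basis i) y", OF add2[OF this] y]
    show "B (basis i) y = (\<Sum>j<r. B (basis i) (basis j) * coeff y j)" by (simp add: mult.commute)
  qed
  finally show ?thesis .
qed

lemma mat_of_compose:
  assumes f: "f \<in> auto L" and g: "g \<in> auto L"
  shows "mat_of (compose (carrier L) f g) = mat_of f * mat_of g"
proof (rule eq_matI)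
  fix i j assume "i < dim_row (mat_of f * mat_of g)" "j < dim_col (mat_of f * mat_of g)"
  then have ij: "i < r" "j < r" by (simp_all add: mat_of_def)
  have gj: "g (basis j) \<in> carrier L" using g ij by (auto simp: auto_def hom_def Pi_iff)
  have "mat_of (compose (carrier L) f g) $$ (i, j) = real_of_int (coeff (f (g (basis j))) i)"
    using ij by (simp add: mat_of_def compose_def)
  also have "\<dots> = (\<Sum>k<r. real_of_int (coeff (f (basis k)) i) * real_of_int (coeff (g (basis j)) k))"
    unfolding coeff_image[OF f gj] by (simp add: mult.commute)
  also have "\<dots> = (mat_of f * mat_of g) $$ (i, j)"
    using ij by (simp add: mat_of_def scalar_prod_def atLeast0LessThan)
  finally show "mat_of (compose (carrier L) f g) $$ (i, j) = (mat_of f * mat_of g) $$ (i, j)" .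
qed (simp_all add: mat_of_def)

lemma mat_of_isometry:
  assumes f: "f \<in> isometries L B"
  shows "transpose_mat (mat_of f) * (gram * mat_of f) = gram"
proof (rule eq_matI)
  fix i j assume "i < dim_row gram" "j < dim_col gram"
  then have ij: "i < r" "j < r" by (simp_all add: gram_matrix_def)
  have fc: "f (basis k) \<in> carrier L" if "k < r" for k
    using f that by (auto simp: isometries_def auto_def hom_def Pi_iff)
  have "(transpose_mat (mat_of f) * (gram * mat_of f)) $$ (i, j) =
      (\<Sum>k<r. real_of_int (coeff (f (basis i)) k) * (\<Sum>l<r. real_of_int (B (basis k) (basis l)) * real_of_int (coeff (f (basis j)) l)))"
    using ij by (simp add: mat_of_def gram_matrix_def scalar_prod_def atLeast0LessThan)
  also have "\<dots> = real_of_int (B (f (basis i)) (f (basis j)))"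
    unfolding form_coeff[OF fc[OF ij(1)] fc[OF ij(2)]] by simp
  also have "B (f (basis i)) (f (basis j)) = B (basis i) (basis j)"
    using f ij by (simp add: isometries_def)
  also have "real_of_int \<dots> = gram $$ (i, j)" using ij by (simp add: gram_matrix_def)
  finally show "(transpose_mat (mat_of f) * (gram * mat_of f)) $$ (i, j) = gram $$ (i, j)" .
qed (simp_all add: mat_of_def gram_matrix_def)

lemma inj_on_mat_of: "inj_on mat_of (auto L)"
proof (rule inj_onI)
  fix f g assume f: "f \<in> auto L" and g: "g \<in> auto L" and eq: "mat_of f = mat_of g"
  have fg: "f x \<in> carrier L" "g x \<in> carrier L" if "x \<in> carrier L" for x
    using f g that by (auto simp: auto_def hom_def Pi_iff)
  have coeff_eq: "coeff (f (basis j)) i = coeff (g (basis j)) i" if "i < r" "j < r" for i j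
  proof -
    have "mat_of f $$ (i, j) = mat_of g $$ (i, j)" using eq by simp
    then show ?thesis using that by (simp add: mat_of_def)
  qed
  have "f x = g x" if x: "x \<in> carrier L" for x
  proof (rule eq_of_coeff_eq)
    fix i assume "i < r"
    then show "coeff (f x) i = coeff (g x) i"
      unfolding coeff_image[OF f x] coeff_image[OF g x] by (intro sum.cong) (use coeff_eq in auto)
  qed (use fg x in auto)
  moreover have "f \<in> extensional (carrier L)" "g \<in> extensional (carrier L)"
    using f g by (auto simp: auto_def Bij_def)
  ultimately show "f = g" by (intro extensionalityI)
qed

lemma integral_lorentz_action:
  assumes "subgroup G (isometry_group L B)"
  shows "integral_lorentz_action r gram (isometry_group L B\<lparr>carrier := G\<rparr>) mat_of"
proof -
  have sym: "transpose_mat gram = gram"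
    by (rule eq_matI) (auto simp: gram_matrix_def form_sym)
  interpret lorentz_form r gram
    by unfold_locales (auto simp: gram_carrier sym signature)
  have grp: "Group.group (isometry_group L B\<lparr>carrier := G\<rparr>)"
    using group.subgroup_imp_group[OF group_isometry_group assms] .
  have G: "f \<in> isometries L B" "f \<in> auto L" if "f \<in> G" for f
    using subgroup.mem_carrier[OF assms that] by (auto simp: isometry_group_def isometries_def)
  have mult: "f \<otimes>\<^bsub>isometry_group L B\<lparr>carrier := G\<rparr>\<^esub> g = compose (carrier L) f g" if "f \<in> G" "g \<in> G" for f g
    using G[OF that(1)] G[OF that(2)] by (simp add: isometry_group_def AutoGroup_def BijGroup_def auto_def)
  have one: "\<one>\<^bsub>isometry_group L B\<lparr>carrier := G\<rparr>\<^esub> = (\<lambda>x \<in> carrier L. x)"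
    by (simp add: isometry_group_def AutoGroup_def BijGroup_def)
  show ?thesis
  proof (intro_locales)
    show "Group.monoid (isometry_group L B\<lparr>carrier := G\<rparr>)" "group_axioms (isometry_group L B\<lparr>carrier := G\<rparr>)"
      using grp by (auto simp: Group.group_def)
    show "integral_lorentz_action_axioms r gram (isometry_group L B\<lparr>carrier := G\<rparr>) mat_of"
    proof
      fix f g assume fg: "f \<in> carrier (isometry_group L B\<lparr>carrier := G\<rparr>)" "g \<in> carrier (isometry_group L B\<lparr>carrier := G\<rparr>)"
      then show "mat_of (f \<otimes>\<^bsub>isometry_group L B\<lparr>carrier := G\<rparr>\<^esub> g) = mat_of f * mat_of g"
        using mult G mat_of_compose by simp
    next
      show "mat_of \<one>\<^bsub>isometry_group L B\<lparr>carrier := G\<rparr>\<^esub> = 1\<^sub>m r"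
        unfolding one by (rule eq_matI) (auto simp: mat_of_def coeff_basis)
      show "inj_on mat_of (carrier (isometry_group L B\<lparr>carrier := G\<rparr>))"
        by (rule inj_on_subset[OF inj_on_mat_of]) (use G in auto)
    next
      fix f and x y :: "real vec" assume f: "f \<in> carrier (isometry_group L B\<lparr>carrier := G\<rparr>)" and x: "x \<in> carrier_vec r" and y: "y \<in> carrier_vec r"
      have F: "mat_of f \<in> carrier_mat r r" by (simp add: mat_of_def)
      have My: "gram *\<^sub>v (mat_of f *\<^sub>v y) \<in> carrier_vec r"
        using F y gram_carrier by (intro mult_mat_vec_carrier)
      have "bil (mat_of f *\<^sub>v x) (mat_of f *\<^sub>v y) = (gram *\<^sub>v (mat_of f *\<^sub>v y)) \<bullet> (mat_of f *\<^sub>v x)"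
        unfolding bil_def using F x My by (intro comm_scalar_prod[of _ r]) (auto intro: mult_mat_vec_carrier)
      also have "\<dots> = (transpose_mat (mat_of f) *\<^sub>v (gram *\<^sub>v (mat_of f *\<^sub>v y))) \<bullet> x"
        using transpose_vec_mult_scalar[OF F x My] by simp
      also have "transpose_mat (mat_of f) *\<^sub>v (gram *\<^sub>v (mat_of f *\<^sub>v y)) = (transpose_mat (mat_of f) * (gram * mat_of f)) *\<^sub>v y"
        using assoc_mult_mat_vec[OF _ mult_carrier_mat[OF gram_carrier F] y, of "transpose_mat (mat_of f)" r]
          assoc_mult_mat_vec[OF gram_carrier F y] F by simp
      also have "\<dots> = gram *\<^sub>v y" using mat_of_isometry G f by simp
      also have "(gram *\<^sub>v y) \<bullet> x = bil x y"
        unfolding bil_def using x y gram_carrier by (intro comm_scalar_prod[of _ r]) (auto intro: mult_mat_vec_carrier)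
      finally show "bil (mat_of f *\<^sub>v x) (mat_of f *\<^sub>v y) = bil x y" .
    qed (auto simp: mat_of_def gram_matrix_def)
  qed
qed

end

theorem theorem2p6:
  fixes L :: "('a, 'b) monoid_scheme"
    and B :: "'a \<Rightarrow> 'a \<Rightarrow> int"
    and r :: nat
    and G :: "('a \<Rightarrow> 'a) set"
  assumes "hyperbolic_lattice L B r"
    and "subgroup G (isometry_group L B)"
    and "virtually_solvable ((isometry_group L B)\<lparr>carrier := G\<rparr>)"
  shows "almost_abelian_finite_rank ((isometry_group L B)\<lparr>carrier := G\<rparr>)"
proof -
  interpret hyperbolic_lattice L B r by (rule assms(1))
  obtain \<phi> where \<phi>: "\<phi> \<in> iso (Z_power r) L" "matrix_signature (gram_matrix B r \<phi>) = (1, 0, r - 1)"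
    using hyperbolic by blast
  interpret based_hyperbolic_lattice L B r \<phi>
    by unfold_locales (use \<phi> in auto)
  let ?G = "(isometry_group L B)\<lparr>carrier := G\<rparr>"
  interpret G: integral_lorentz_action r gram ?G mat_of
    by (rule integral_lorentz_action[OF assms(2)])
  obtain H where H: "subgroup H ?G" "finite_index ?G H" "solvable (?G\<lparr>carrier := H\<rparr>)"
    using assms(3) unfolding virtually_solvable_def by blast
  have "virtually_finite_by_lattice (?G\<lparr>carrier := H\<rparr>)"
    by (rule integral_lorentz_action.virtually_finite_by_lattice_of_solvable[OF G.restrict_to_subgroup[OF H(1)] H(3)])
  then show ?thesis
    by (intro G.almost_abelian_of_virtually_finite_by_lattice G.virtually_finite_by_lattice_of_subgroup[OF H(1,2)])
qed

end
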